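(* Fix integers $n, m \geq 1$, an open set $U \subseteq \mathbf C^n$ containing $\mathbf T^n$, and a holomorphic function $f \colon U \to \mathbf C$. Then for every real $\delta > 0$ such that $U$ contains the annulus $\mathcal C_\delta$, and every matrix $A \in \mathbf Z^{m\times n}$ such that $\rho(A) \geq \frac{2 d(A)}{3\delta}$, we have \[ \left| \int_{\mathbf T^n} f \, d\mu_A - \int_{\mathbf T^n} f\, d\mu_n \right| \leq (d(A)+1)\, 3^{d(A)} \cdot \frac{\max_{\mathcal C_\delta} |f|}{\exp(\delta \rho(A))}, \] where $d(A) := \dim_{\mathbf R}(\ker A)$.
   Context: $\mathbf T^n = \{z \in \mathbf C^n : |z_1| = \cdots = |z_n| = 1\}$; $\mu_n$ is the probability Haar measure on $\mathbf T^n$. For $A = (a_{i,j}) \in \mathbf Z^{m \times n}$, $\mu_A$ is the push-forward of $\mu_m$ under the map $\mathbf T^m \to \mathbf T^n$, $(z_1,\dots,z_m) \mapsto (z_1^{a_{1,1}}\cdots z_m^{a_{m,1}},\dots,z_1^{a_{1,n}}\cdots z_m^{a_{m,n}})$. $\rho(A) := \min\{\|v\|_\infty : v \in \mathbf Z^n\setminus\{0\}, Av = 0\}$ ($+\infty$ if no such $v$), and $\ker A \subseteq \mathbf R^n$. For $\delta > 0$, $\mathcal C_\delta := \{z \in (\mathbf C^\times)^n : \sum_{i=1}^n |\log|z_i|| \leq \delta\}$. *)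

theory Defs
  imports "HOL-Probability.Probability"
begin

definition torus :: "(complex ^ 'n) set" where
  "torus = {z. \<forall>i. cmod (z $ i) = 1}"

abbreviation torus_borel :: "(complex ^ 'n) measure" where
  "torus_borel \<equiv> restrict_space borel torus"

text \<open>The product of two vectors is componentwise, i.e. the group law of the torus. Every Borel
  probability measure on the torus is regular, so regularity is not listed.\<close>

definition haar_prob :: "(complex ^ 'n) measure \<Rightarrow> bool" where
  "haar_prob \<mu> \<longleftrightarrow> sets \<mu> = sets torus_borel \<and> prob_space \<mu> \<and>
     (\<forall>w\<in>torus. distr \<mu> \<mu> (\<lambda>z. w * z) = \<mu>)"

definition haar_torus :: "(complex ^ 'n) measure" where
  "haar_torus = (THE \<mu>. haar_prob \<mu>)"

lemma vec_times_nth: "(x * y) $ i = x $ i * y $ i" for x y :: "complex ^ 'n"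
  by (simp add: times_vec_def)

lemma continuous_on_vec_times [continuous_intros]:
  fixes f g :: "'a::topological_space \<Rightarrow> complex ^ 'n"
  assumes "continuous_on S f" "continuous_on S g"
  shows "continuous_on S (\<lambda>x. f x * g x)"
  unfolding times_vec_def using assms by (intro continuous_intros)

lemma torus_times_closed: "w \<in> torus \<Longrightarrow> z \<in> torus \<Longrightarrow> w * z \<in> torus"
  by (auto simp: torus_def vec_times_nth norm_mult)

lemma measurable_torus_times:
  "(\<lambda>(w, z). w * z) \<in> torus_borel \<Otimes>\<^sub>M torus_borel \<rightarrow>\<^sub>M (torus_borel :: (complex ^ 'n) measure)"
proof (rule measurable_restrict_space2)
  show "(\<lambda>(w, z). w * z) \<in> space (torus_borel \<Otimes>\<^sub>M torus_borel) \<rightarrow> (torus :: (complex ^ 'n) set)"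
    by (auto simp: space_pair_measure space_restrict_space intro: torus_times_closed)
  have 1: "(\<lambda>p. fst p * snd p) \<in> borel_measurable (borel :: ((complex^'n) \<times> (complex^'n)) measure)"
    by (intro borel_measurable_continuous_onI continuous_intros)
  have 2: "(\<lambda>p. (fst p, snd p)) \<in> (torus_borel \<Otimes>\<^sub>M torus_borel) \<rightarrow>\<^sub>M
      (borel \<Otimes>\<^sub>M borel :: ((complex^'n) \<times> (complex^'n)) measure)"
    by (intro measurable_Pair measurable_compose[OF measurable_fst] measurable_compose[OF measurable_snd]
        measurable_restrict_space1 measurable_ident_sets refl)
  show "(\<lambda>(w, z). w * z) \<in> torus_borel \<Otimes>\<^sub>M torus_borel \<rightarrow>\<^sub>M (borel :: (complex ^ 'n) measure)"
    using measurable_compose[OF 2[unfolded borel_prod] 1] by (simp add: case_prod_unfold)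
qed

lemma haar_prob_unique:
  fixes \<mu> \<nu> :: "(complex ^ 'n) measure"
  assumes \<mu>: "haar_prob \<mu>" and \<nu>: "haar_prob \<nu>"
  shows "\<mu> = \<nu>"
proof (rule measure_eqI)
  interpret M: prob_space \<mu> using \<mu> by (simp add: haar_prob_def)
  interpret N: prob_space \<nu> using \<nu> by (simp add: haar_prob_def)
  interpret pair_sigma_finite \<mu> \<nu> ..
  have sets [measurable_cong]: "sets \<mu> = sets torus_borel" "sets \<nu> = sets torus_borel"
    using \<mu> \<nu> by (auto simp: haar_prob_def)
  have space: "space \<mu> = torus" "space \<nu> = torus"
    using sets[THEN sets_eq_imp_space_eq] by (auto simp: space_restrict_space)
  note [measurable] = measurable_torus_times
  show "sets \<mu> = sets \<nu>" using sets by simp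
  fix B assume "B \<in> sets \<mu>"
  then have B [measurable]: "B \<in> sets torus_borel" using sets by simp
  have inv: "emeasure K B = (\<integral>\<^sup>+ x. indicator B (w * x) \<partial>K)"
    if K: "haar_prob K" and w: "w \<in> torus" for K w
  proof -
    have K' [measurable_cong]: "sets K = sets torus_borel" using K by (simp add: haar_prob_def)
    have sK: "w \<in> space torus_borel" using w by (simp add: space_restrict_space)
    have m: "(\<lambda>z. w * z) \<in> torus_borel \<rightarrow>\<^sub>M torus_borel"
      using measurable_compose[OF measurable_Pair1'[OF sK] measurable_torus_times] by simp
    have m': "(\<lambda>z. w * z) \<in> K \<rightarrow>\<^sub>M K" using m by (simp cong: measurable_cong_sets add: K')
    have "emeasure K B = emeasure (distr K K (\<lambda>z. w * z)) B"
      using K w by (simp add: haar_prob_def)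
    also have "\<dots> = (\<integral>\<^sup>+ x. indicator B x \<partial>distr K K (\<lambda>z. w * z))"
      using B K' by simp
    also have "\<dots> = (\<integral>\<^sup>+ x. indicator B (w * x) \<partial>K)"
      using B K' by (intro nn_integral_distr m') auto
    finally show ?thesis .
  qed
  have ind: "(\<lambda>(x, y). indicator B (y * x) :: ennreal) \<in> borel_measurable (\<mu> \<Otimes>\<^sub>M \<nu>)"
    using measurable_compose[OF measurable_torus_times borel_measurable_indicator[OF B, where 'b=ennreal]]
    by (simp add: mult.commute case_prod_unfold times_vec_def cong: measurable_cong_sets sets_pair_measure_cong[OF sets])
  have "emeasure \<mu> B = (\<integral>\<^sup>+ y. emeasure \<mu> B \<partial>\<nu>)"
    by (simp add: N.emeasure_space_1)
  also have "\<dots> = (\<integral>\<^sup>+ y. \<integral>\<^sup>+ x. indicator B (y * x) \<partial>\<mu> \<partial>\<nu>)"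
    by (intro nn_integral_cong inv \<mu>) (simp add: space)
  also have "\<dots> = (\<integral>\<^sup>+ x. \<integral>\<^sup>+ y. indicator B (y * x) \<partial>\<nu> \<partial>\<mu>)"
    by (rule Fubini'[OF ind])
  also have "\<dots> = (\<integral>\<^sup>+ x. emeasure \<nu> B \<partial>\<mu>)"
    by (intro nn_integral_cong) (subst inv[OF \<nu>], auto simp: space times_vec_def mult.commute)
  also have "\<dots> = emeasure \<nu> B"
    by (simp add: M.emeasure_space_1)
  finally show "emeasure \<mu> B = emeasure \<nu> B" .
qed

definition circle_prob :: "complex measure" where
  "circle_prob = distr (uniform_measure lborel {0..<1::real}) (restrict_space borel (sphere 0 1))
     (\<lambda>t. cis (2 * pi * t))"

lemma sets_circle_prob [measurable_cong]: "sets circle_prob = sets (restrict_space borel (sphere 0 1))"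
  and space_circle_prob: "space circle_prob = sphere 0 1"
  by (auto simp: circle_prob_def space_restrict_space)

lemma measurable_cis_circle:
  "(\<lambda>t. cis (2 * pi * t)) \<in> borel \<rightarrow>\<^sub>M restrict_space borel (sphere 0 1)"
  by (intro measurable_restrict_space2 borel_measurable_continuous_onI continuous_intros) auto

lemma prob_space_circle_prob: "prob_space circle_prob"
  unfolding circle_prob_def
  by (intro prob_space.prob_space_distr prob_space_uniform_measure)
     (use measurable_cis_circle in \<open>auto cong: measurable_cong_sets\<close>)

lemma emeasure_circle_prob:
  assumes "S \<in> sets (restrict_space borel (sphere 0 1))"
  shows "emeasure circle_prob S = emeasure lborel ({0..<1} \<inter> {t. cis (2 * pi * t) \<in> S})"
proof -
  have m: "{t. cis (2 * pi * t) \<in> S} \<in> sets borel"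
    using measurable_sets[OF measurable_cis_circle assms] by (simp add: vimage_def)
  show ?thesis unfolding circle_prob_def
    using m assms measurable_cis_circle
    by (subst emeasure_distr) (auto cong: measurable_cong_sets simp: vimage_def divide_ennreal_def)
qed

lemma measurable_circle_mult:
  assumes "cmod w = 1"
  shows "(\<lambda>z. w * z) \<in> restrict_space borel (sphere 0 1) \<rightarrow>\<^sub>M restrict_space borel (sphere 0 1)"
  using assms by (intro measurable_restrict_space3 borel_measurable_continuous_onI continuous_intros)
     (auto simp: norm_mult)

lemma circle_prob_invariant:
  assumes w: "cmod w = 1" and S: "S \<in> sets (restrict_space borel (sphere 0 1))"
  shows "emeasure circle_prob ((\<lambda>z. w * z) -` S \<inter> sphere 0 1) = emeasure circle_prob S"
proof -
  define B where "B = {t::real. cis (2 * pi * t) \<in> S}"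
  have B [measurable]: "B \<in> sets borel"
    using measurable_sets[OF measurable_cis_circle S] by (simp add: vimage_def B_def)
  define s where "s = frac (Arg w / (2 * pi))"
  have s: "0 \<le> s" "s < 1" by (auto simp: s_def frac_lt_1)
  have cw: "w = cis (2 * pi * s)"
  proof -
    have "cis (2 * pi * s) = cis (Arg w - 2 * pi * of_int \<lfloor>Arg w / (2 * pi)\<rfloor>)"
      by (simp add: s_def frac_def algebra_simps)
    also have "\<dots> = cis (Arg w)"
      by (simp add: cis_divide[symmetric] cis_multiple_2pi)
    also have "\<dots> = w" 
    proof -
      have "w \<noteq> 0" using w by auto
      then show ?thesis using w by (simp add: cis_Arg sgn_div_norm)
    qed
    finally show ?thesis by simp
  qed
  have per: "t + 1 \<in> B \<longleftrightarrow> t \<in> B" for t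
  proof -
    have "cis (2 * pi * (t + 1)) = cis (2 * pi * t)"
      by (simp add: distrib_left cis_mult[symmetric])
    then show ?thesis by (simp add: B_def)
  qed
  have tr: "emeasure lborel {t. c + t \<in> X} = emeasure lborel X" if "X \<in> sets borel" for X and c :: real
    using arg_cong[OF lborel_distr_plus[of c], of "\<lambda>M. emeasure M X"] that
    by (subst (asm) emeasure_distr) (auto simp: vimage_def)
  have wS: "(\<lambda>z. w * z) -` S \<inter> sphere 0 1 \<in> sets (restrict_space borel (sphere 0 1))"
    using measurable_sets[OF measurable_circle_mult[OF w] S] by (simp add: space_restrict_space)
  have "emeasure circle_prob ((\<lambda>z. w * z) -` S \<inter> sphere 0 1) =
      emeasure lborel {t. s + t \<in> {s..<1 + s} \<inter> B}"
    unfolding emeasure_circle_prob[OF wS]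
    by (rule arg_cong[where f = "emeasure lborel"])
       (auto simp: cw B_def cis_mult distrib_left)
  also have "\<dots> = emeasure lborel ({s..<1 + s} \<inter> B)"
    by (rule tr) auto
  also have "\<dots> = emeasure lborel (({s..<1} \<inter> B) \<union> ({1..<1 + s} \<inter> B))"
    using s by (intro arg_cong[where f = "emeasure lborel"]) auto
  also have "\<dots> = emeasure lborel ({s..<1} \<inter> B) + emeasure lborel ({1..<1 + s} \<inter> B)"
    by (subst plus_emeasure) auto
  also have "emeasure lborel ({1..<1 + s} \<inter> B) = emeasure lborel {t. 1 + t \<in> {1..<1 + s} \<inter> B}"
    by (rule tr[symmetric]) auto
  also have "{t. 1 + t \<in> {1..<1 + s} \<inter> B} = {0..<s} \<inter> B"
    using per by (auto simp: add.commute)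
  also have "emeasure lborel ({s..<1} \<inter> B) + emeasure lborel ({0..<s} \<inter> B) =
      emeasure lborel (({s..<1} \<inter> B) \<union> ({0..<s} \<inter> B))"
    by (subst plus_emeasure) auto
  also have "({s..<1} \<inter> B) \<union> ({0..<s} \<inter> B) = {0..<1} \<inter> B"
    using s by auto
  also have "emeasure lborel \<dots> = emeasure circle_prob S"
    unfolding emeasure_circle_prob[OF S] B_def ..
  finally show ?thesis .
qed

lemma haar_prob_exists: "\<exists>\<mu> :: (complex ^ 'n) measure. haar_prob \<mu>"
proof -
  interpret circle: prob_space circle_prob by (rule prob_space_circle_prob)
  interpret product_prob_space "\<lambda>_::'n. circle_prob" by unfold_locales
  define P where "P = PiM (UNIV :: 'n set) (\<lambda>_. circle_prob)"
  define \<mu> where "\<mu> = distr P torus_borel (\<lambda>x. \<chi> i. x i)"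
  interpret Q: prob_space P unfolding P_def by (rule prob_space_PiM) (rule prob_space_circle_prob)
  have comp: "(\<lambda>x. x i) \<in> P \<rightarrow>\<^sub>M borel" for i
    using measurable_component_singleton[of i UNIV "\<lambda>_. circle_prob"]
    unfolding P_def by (simp add: measurable_restrict_space2_iff cong: measurable_cong_sets[OF refl sets_circle_prob])
  have lam: "(\<lambda>x. \<chi> i. x i) \<in> P \<rightarrow>\<^sub>M torus_borel"
  proof (rule measurable_restrict_space2)
    show "(\<lambda>x. \<chi> i. x i) \<in> space P \<rightarrow> torus"
      by (auto simp: P_def space_PiM space_circle_prob torus_def PiE_def Pi_def)
    show "(\<lambda>x. \<chi> i. x i) \<in> borel_measurable P"
      by (subst borel_measurable_euclidean_space)
         (auto simp: Basis_vec_def inner_axis intro!: borel_measurable_inner comp)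
  qed
  have "distr \<mu> \<mu> (\<lambda>z. w * z) = \<mu>" if w: "w \<in> torus" for w
  proof -
    define h where "h = (\<lambda>x. \<lambda>i\<in>UNIV. w $ i * x i)"
    have w': "cmod (w $ i) = 1" for i using w by (simp add: torus_def)
    have mi: "(\<lambda>z. w $ i * z) \<in> circle_prob \<rightarrow>\<^sub>M circle_prob" for i
      using measurable_circle_mult[OF w'] by (simp cong: measurable_cong_sets add: sets_circle_prob)
    have h: "h \<in> P \<rightarrow>\<^sub>M P"
      unfolding h_def P_def
      by (intro measurable_restrict measurable_compose[OF _ mi] measurable_component_singleton) auto
    have hP: "distr P P h = P"
    proof -
      have "distr P P h = PiM UNIV (\<lambda>_. circle_prob)"
      proof (rule PiM_eqI)
        fix X :: "'n \<Rightarrow> complex set" assume X: "\<And>i. i \<in> UNIV \<Longrightarrow> X i \<in> sets circle_prob"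
        have "emeasure (distr P P h) (Pi\<^sub>E UNIV X) = emeasure P (h -` Pi\<^sub>E UNIV X \<inter> space P)"
          using X by (intro emeasure_distr h) (auto simp: P_def intro!: sets_PiM_I_finite)
        also have "h -` Pi\<^sub>E UNIV X \<inter> space P = Pi\<^sub>E UNIV (\<lambda>i. (\<lambda>z. w $ i * z) -` X i \<inter> sphere 0 1)"
          by (auto simp: P_def space_PiM space_circle_prob h_def PiE_def Pi_def)
        also have "emeasure P \<dots> = (\<Prod>i\<in>UNIV. emeasure circle_prob ((\<lambda>z. w $ i * z) -` X i \<inter> sphere 0 1))"
          unfolding P_def using measurable_sets[OF mi X]
          by (intro emeasure_PiM) (auto simp: space_circle_prob)
        also have "\<dots> = (\<Prod>i\<in>UNIV. emeasure circle_prob (X i))"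
          using X by (intro prod.cong refl circle_prob_invariant w') (simp add: sets_circle_prob)
        finally show "emeasure (distr P P h) (Pi\<^sub>E UNIV X) = (\<Prod>i\<in>UNIV. emeasure circle_prob (X i))" .
      qed (auto simp: P_def)
      then show ?thesis by (simp add: P_def)
    qed
    have sw: "w \<in> space torus_borel" using w by (simp add: space_restrict_space)
    have m: "(\<lambda>z. w * z) \<in> torus_borel \<rightarrow>\<^sub>M torus_borel"
      using measurable_compose[OF measurable_Pair1'[OF sw] measurable_torus_times] by simp
    have "distr \<mu> \<mu> (\<lambda>z. w * z) = distr \<mu> torus_borel (\<lambda>z. w * z)"
      by (rule distr_cong) (auto simp: \<mu>_def)
    also have "\<dots> = distr P torus_borel ((\<lambda>z. w * z) \<circ> (\<lambda>x. \<chi> i. x i))"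
      unfolding \<mu>_def by (rule distr_distr[OF m lam])
    also have "(\<lambda>z. w * z) \<circ> (\<lambda>x. \<chi> i. x i) = (\<lambda>x. \<chi> i. x i) \<circ> h"
      by (auto simp: fun_eq_iff h_def vec_eq_iff vec_times_nth)
    also have "distr P torus_borel \<dots> = distr (distr P P h) torus_borel (\<lambda>x. \<chi> i. x i)"
      by (rule distr_distr[symmetric, OF lam h])
    also have "\<dots> = \<mu>" by (simp add: hP \<mu>_def)
    finally show ?thesis .
  qed
  moreover have "prob_space \<mu>" unfolding \<mu>_def by (rule Q.prob_space_distr[OF lam])
  ultimately have "haar_prob \<mu>" by (auto simp: haar_prob_def \<mu>_def)
  then show ?thesis ..
qed

lemma haar_prob_haar_torus: "haar_prob (haar_torus :: (complex ^ 'n) measure)"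
  unfolding haar_torus_def using haar_prob_exists haar_prob_unique by (metis theI)

definition torus_hom :: "int ^ 'n ^ 'm \<Rightarrow> complex ^ 'm \<Rightarrow> complex ^ 'n" where
  "torus_hom A z = (\<chi> j. \<Prod>i\<in>UNIV. (z $ i) powi (A $ i $ j))"

definition haar_push :: "int ^ 'n ^ 'm \<Rightarrow> (complex ^ 'n) measure" where
  "haar_push A = distr haar_torus torus_borel (torus_hom A)"

lemma measurable_torus_hom: "torus_hom A \<in> torus_borel \<rightarrow>\<^sub>M torus_borel"
proof (rule measurable_restrict_space2)
  show "torus_hom A \<in> space torus_borel \<rightarrow> torus"
    by (auto simp: space_restrict_space torus_def torus_hom_def prod_norm[symmetric] norm_power_int)
  have "continuous_on torus (torus_hom A)"
    unfolding torus_hom_def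
    by (intro continuous_intros ballI) (auto simp: torus_def; metis norm_zero zero_neq_one)+
  then show "torus_hom A \<in> borel_measurable torus_borel"
    by (rule borel_measurable_continuous_on_restrict)
qed

definition int_supnorm :: "int ^ 'n \<Rightarrow> nat" where
  "int_supnorm v = Max (range (\<lambda>j. nat \<bar>v $ j\<bar>))"

text \<open>In \<^typ>\<open>enat\<close> the infimum of a nonempty set is its least element, and that of the
  empty set is \<open>\<infinity>\<close>.\<close>

definition rho :: "int ^ 'n ^ 'm \<Rightarrow> enat" where
  "rho A = Inf {enat (int_supnorm v) | v. v \<noteq> 0 \<and> A *v v = 0}"

definition real_ker :: "int ^ 'n ^ 'm \<Rightarrow> (real ^ 'n) set" where
  "real_ker A = {x. (\<chi> i j. real_of_int (A $ i $ j)) *v x = 0}"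

definition ker_dim :: "int ^ 'n ^ 'm \<Rightarrow> nat" where
  "ker_dim A = dim (real_ker A)"

definition holomorphic_several :: "(complex ^ 'n \<Rightarrow> complex) \<Rightarrow> (complex ^ 'n) set \<Rightarrow> bool" where
  "holomorphic_several f U \<longleftrightarrow>
     (\<forall>z\<in>U. \<exists>D. (f has_derivative D) (at z) \<and> (\<forall>c v. D (c *s v) = c * D v))"

definition annulus :: "real \<Rightarrow> (complex ^ 'n) set" where
  "annulus \<delta> = {z. (\<forall>i. z $ i \<noteq> 0) \<and> (\<Sum>i\<in>UNIV. \<bar>ln (cmod (z $ i))\<bar>) \<le> \<delta>}"

lemma compact_annulus: "compact (annulus \<delta> :: (complex ^ 'n) set)"
proof -
  define K :: "(complex ^ 'n) set"
    where "K = {z. \<forall>i. exp (-\<delta>) \<le> cmod (z $ i) \<and> cmod (z $ i) \<le> exp \<delta>}"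
  have "bounded K"
  proof (rule boundedI)
    fix z assume "z \<in> K"
    then show "norm z \<le> (\<Sum>i\<in>(UNIV::'n set). exp \<delta>)"
      unfolding norm_vec_def
      by (intro order.trans[OF L2_set_le_sum] sum_mono) (auto simp: K_def)
  qed
  moreover have "closed K"
    unfolding K_def
    by (intro closed_Collect_all closed_Collect_conj closed_Collect_le continuous_intros)
  ultimately have K: "compact K" by (simp add: compact_eq_bounded_closed)
  have nz: "z $ i \<noteq> 0" if "z \<in> K" for z i
    using that by (auto simp: K_def) (metis exp_gt_zero norm_zero not_le)
  have ann: "annulus \<delta> = {z\<in>K. (\<Sum>i\<in>UNIV. \<bar>ln (cmod (z $ i))\<bar>) \<le> \<delta>}"
  proof (intro equalityI subsetI)
    fix z :: "complex ^ 'n" assume z: "z \<in> annulus \<delta>"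
    have "exp (-\<delta>) \<le> cmod (z $ i) \<and> cmod (z $ i) \<le> exp \<delta>" for i
    proof -
      have "\<bar>ln (cmod (z $ i))\<bar> \<le> (\<Sum>i\<in>UNIV. \<bar>ln (cmod (z $ i))\<bar>)"
        by (rule member_le_sum) auto
      also have "\<dots> \<le> \<delta>" using z by (simp add: annulus_def)
      finally have "-\<delta> \<le> ln (cmod (z $ i))" "ln (cmod (z $ i)) \<le> \<delta>" by auto
      moreover have "cmod (z $ i) > 0" using z by (simp add: annulus_def)
      ultimately show ?thesis by (metis exp_le_cancel_iff exp_ln)
    qed
    then show "z \<in> {z\<in>K. (\<Sum>i\<in>UNIV. \<bar>ln (cmod (z $ i))\<bar>) \<le> \<delta>}"
      using z by (auto simp: K_def annulus_def)
  qed (auto simp: annulus_def nz)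
  have "continuous_on K (\<lambda>z. \<Sum>i\<in>UNIV. \<bar>ln (cmod (z $ i))\<bar>)"
    by (intro continuous_intros ballI) (simp add: nz)
  then have "closed {z\<in>K. (\<Sum>i\<in>UNIV. \<bar>ln (cmod (z $ i))\<bar>) \<le> \<delta>}"
    by (intro continuous_on_closed_Collect_le continuous_on_const compact_imp_closed[OF K])
  then have "compact (K \<inter> {z\<in>K. (\<Sum>i\<in>UNIV. \<bar>ln (cmod (z $ i))\<bar>) \<le> \<delta>})"
    by (rule compact_Int_closed[OF K])
  moreover have "K \<inter> {z\<in>K. (\<Sum>i\<in>UNIV. \<bar>ln (cmod (z $ i))\<bar>) \<le> \<delta>} = annulus \<delta>"
    unfolding ann by auto
  ultimately show ?thesis by simp
qed

text \<open>\<open>Max\<close> only applies to finite sets, so the maximum over an annulus is written as a \<open>SUP\<close>;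
  it is attained.\<close>

lemma SUP_annulus_attained:
  fixes f :: "complex ^ 'n \<Rightarrow> complex"
  assumes "holomorphic_several f U" "annulus \<delta> \<subseteq> U" "\<delta> > 0"
  shows "\<exists>z\<in>annulus \<delta>. cmod (f z) = (SUP z\<in>annulus \<delta>. cmod (f z)) \<and>
           (\<forall>y\<in>annulus \<delta>. cmod (f y) \<le> cmod (f z))"
proof -
  have "continuous_on (annulus \<delta>) f"
    using assms by (intro continuous_at_imp_continuous_on ballI)
      (auto simp: holomorphic_several_def dest!: has_derivative_continuous)
  then have "continuous_on (annulus \<delta>) (\<lambda>z. cmod (f z))" by (intro continuous_intros)
  moreover have "1 \<in> (annulus \<delta> :: (complex ^ 'n) set)"
    using assms by (simp add: annulus_def one_vec_def)
  ultimately obtain z where z: "z \<in> annulus \<delta>" "\<And>y. y \<in> annulus \<delta> \<Longrightarrow> cmod (f y) \<le> cmod (f z)"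
    using continuous_attains_sup[OF compact_annulus, of \<delta> "\<lambda>z. cmod (f z)"] by blast
  then have "(SUP z\<in>annulus \<delta>. cmod (f z)) = cmod (f z)"
    by (intro cSup_eq_maximum) auto
  with z show ?thesis by auto
qed

definition exp_ereal :: "ereal \<Rightarrow> ereal" where
  "exp_ereal x = (case x of ereal r \<Rightarrow> ereal (exp r) | PInfty \<Rightarrow> \<infinity> | MInfty \<Rightarrow> 0)"

lemma exp_ereal_simps [simp]:
  "exp_ereal (ereal r) = ereal (exp r)" "exp_ereal \<infinity> = \<infinity>" "exp_ereal (-\<infinity>) = 0"
  by (auto simp: exp_ereal_def)

end

theory Submission
  imports Defs "HOL-Complex_Analysis.Cauchy_Integral_Theorem"
begin

text \<open>
  Let \<open>a\<^sub>v\<close> be the Fourier coefficients of \<open>f\<close> on the torus. Moving one circle of integration to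
  radius \<open>exp (\<plusminus> \<delta>)\<close> gives \<open>\<bar>a\<^sub>v\<bar> \<le> M exp (- \<delta> \<parallel>v\<parallel>\<^sub>\<infinity>)\<close>, where \<open>M\<close> is the maximum of \<open>\<bar>f\<bar>\<close> on the annulus,
  so the Fourier series converges absolutely to \<open>f\<close>. A character \<open>z\<^sup>v\<close> has \<open>\<mu>\<^sub>A\<close>-integral 1 or 0
  according to whether \<open>A v = 0\<close>, hence the difference of the two integrals is the sum of \<open>a\<^sub>v\<close> over
  the nonzero integer vectors \<open>v\<close> of \<open>ker A\<close>. These vectors are \<open>\<rho>\<close>-separated in a space of dimension
  \<open>d\<close>, so at most \<open>(1 + 2 t / \<rho>) ^ d\<close> of them have norm at most \<open>t\<close>, and integrating this count
  against \<open>\<delta> exp (- \<delta> t)\<close> over \<open>t \<ge> \<rho>\<close> gives \<open>exp (- \<delta> \<rho>) 3 ^ d (\<Sum>j\<le>d. d! / (d - j)! (2 / (3 \<rho> \<delta>)) ^ j)\<close>,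
  where each summand is at most 1 by the hypothesis on \<open>\<rho>\<close>.
\<close>

section \<open>Separated sets in normed spaces\<close>

text \<open>Volume packing: the sup-norm balls of radius \<rho>/2 in \<open>V\<close> around the
  points of \<open>S\<close> are disjoint and lie in the ball of radius t + \<rho>/2, and volumes in
  \<open>V\<close> scale with exponent \<open>dim V\<close>. Since \<open>V\<close> may be a
  Lebesgue null set, it is carried linearly onto a coordinate subspace and the balls are thickened
  by a fixed cube in the remaining coordinates.\<close>

lemma card_separated_le:
  fixes V :: "(real ^ 'n) set"
  assumes V: "subspace V" and S: "finite S" "S \<subseteq> V" and "0 < \<rho>" "0 \<le> t"
    and sep: "\<And>x y. x \<in> S \<Longrightarrow> y \<in> S \<Longrightarrow> x \<noteq> y \<Longrightarrow> \<rho> \<le> infnorm (x - y)"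
    and bd: "\<And>x. x \<in> S \<Longrightarrow> infnorm x \<le> t"
  shows "real (card S) \<le> (1 + 2 * t / \<rho>) ^ dim V"
proof -
  obtain I :: "'n set" where I: "card I = dim V"
    using obtain_subset_with_card_n[of "dim V" "UNIV :: 'n set"] dim_subset_UNIV_cart[of V] by auto
  define T :: "(real ^ 'n) set" where "T = {x. \<forall>i. i \<notin> I \<longrightarrow> x $ i = 0}"
  have T: "subspace T" by (auto simp: T_def subspace_def)
  have "dim V = dim T"
    using dim_substandard_cart[of I, where 'a = real] by (simp add: T_def I dim_vec_eq)
  then obtain f g where fg: "linear f" "linear g" "f ` V = T" "\<And>x. x \<in> T \<Longrightarrow> norm (g x) = norm x"
      "\<And>x. x \<in> V \<Longrightarrow> g (f x) = x"
    using isometries_subspaces[OF V T] by metis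
  define P :: "real ^ 'n \<Rightarrow> real ^ 'n" where "P x = (\<chi> i. if i \<in> I then x $ i else 0)" for x
  have P: "linear P" by (auto simp: P_def linear_iff vec_eq_iff)
  \<comment> \<open>The isometry \<open>g\<close> preserves only the Euclidean norm, so the sup norm
    of \<open>V\<close> is pulled back along \<open>g\<close> and the projection \<open>P\<close>.
    The result is a seminorm that ignores the coordinates outside \<open>I\<close>.\<close>
  define q where "q x = infnorm (g (P x))" for x
  have gP: "linear (\<lambda>x. g (P x))" using linear_compose[OF P fg(2)] by (simp add: o_def)
  have PT: "P x \<in> T" for x by (simp add: P_def T_def)
  have Pid: "P x = x" if "x \<in> T" for x using that by (auto simp: P_def T_def vec_eq_iff)
  have qf: "g (P (f x)) = x" if "x \<in> V" for x using that fg Pid by auto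
  \<comment> \<open>The tube of width 1 around the ball of radius \<open>r\<close> in \<open>V\<close>; its volume is proportional to \<open>r ^ dim V\<close>.\<close>
  define C where "C r = {x. q x < r \<and> (\<forall>i. i \<notin> I \<longrightarrow> \<bar>x $ i\<bar> < 1)}" for r
  have cq: "continuous_on UNIV q"
    unfolding q_def by (intro continuous_intros linear_continuous_on linear_conv_bounded_linear[THEN iffD1] gP)
  have openC: "open (C r)" for r
  proof -
    have "open {x :: real ^ 'n. i \<notin> I \<longrightarrow> \<bar>x $ i\<bar> < 1}" for i
      by (cases "i \<in> I") (auto intro!: open_Collect_less continuous_intros)
    then have "open (\<Inter>i. {x :: real ^ 'n. i \<notin> I \<longrightarrow> \<bar>x $ i\<bar> < 1})" by (intro open_INT) auto
    moreover have "open {x. q x < r}" by (intro open_Collect_less cq continuous_intros)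
    moreover have "C r = {x. q x < r} \<inter> (\<Inter>i. {x. i \<notin> I \<longrightarrow> \<bar>x $ i\<bar> < 1})" by (auto simp: C_def)
    ultimately show ?thesis by (simp add: open_Int)
  qed
  have "bounded (C 1)"
  proof (rule boundedI)
    fix x assume x: "x \<in> C 1"
    \<comment> \<open>\<open>g\<close> is isometric on \<open>T\<close>, and the Euclidean norm is
      at most sqrt n times the sup norm.\<close>
    have n: "norm (P x) \<le> sqrt (real CARD('n))"
      using norm_le_infnorm[of "g (P x)"] fg(4)[OF PT[of x]] x
      by (simp add: C_def q_def) (smt (verit) mult_left_le of_nat_0_le_iff real_sqrt_ge_zero)
    have "\<bar>x $ i\<bar> \<le> sqrt (real CARD('n)) + 1" for i
    proof (cases "i \<in> I")
      case True
      then have "\<bar>x $ i\<bar> = \<bar>P x $ i\<bar>" by (simp add: P_def)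
      then show ?thesis using component_le_norm_cart[of "P x" i] n by simp
    next
      case False
      then show ?thesis using x by (simp add: C_def) (smt (verit) of_nat_0_le_iff real_sqrt_ge_zero)
    qed
    then show "norm x \<le> (\<Sum>i\<in>(UNIV::'n set). sqrt (real CARD('n)) + 1)"
      by (intro order.trans[OF norm_le_l1_cart] sum_mono)
  qed
  then have C1: "C 1 \<in> lmeasurable" using openC lmeasurable_open by blast
  have Cr: "C r \<in> lmeasurable" "measure lebesgue (C r) = r ^ dim V * measure lebesgue (C 1)" if r: "0 < r" for r
  proof -
    \<comment> \<open>Stretching only the coordinates in \<open>I\<close> carries \<open>C 1\<close>
      onto \<open>C r\<close>; the determinant is r ^ card I.\<close>
    define m where "m i = (if i \<in> I then r else 1)" for i :: 'n
    have Ps: "P (\<chi> k. m k * x $ k) = r *\<^sub>R P x" for x by (auto simp: P_def m_def vec_eq_iff)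
    have qs: "q (\<chi> k. m k * x $ k) = r * q x" for x
      using r by (simp add: q_def Ps linear_cmul[OF fg(2)] infnorm_mul)
    have "C r = (\<lambda>x. \<chi> k. m k * x $ k) ` C 1"
    proof (intro equalityI subsetI)
      fix x assume x: "x \<in> C r"
      define y where "y = (\<chi> k. x $ k / m k)"
      have xy: "x = (\<chi> k. m k * y $ k)" using r by (auto simp: y_def m_def vec_eq_iff)
      have "r * q y < r" using x qs[of y] by (simp add: C_def xy[symmetric])
      then have "y \<in> C 1" using x r by (auto simp: C_def y_def m_def)
      then show "x \<in> (\<lambda>x. \<chi> k. m k * x $ k) ` C 1" using xy by blast
    next
      fix x assume "x \<in> (\<lambda>x. \<chi> k. m k * x $ k) ` C 1"
      then obtain y where y: "x = (\<chi> k. m k * y $ k)" "y \<in> C 1" by blast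
      then have "q x < r" using r by (simp add: C_def qs)
      then show "x \<in> C r" using y by (simp add: C_def m_def)
    qed
    moreover have "prod m UNIV = r ^ dim V"
      unfolding m_def using prod.inter_restrict[of UNIV "\<lambda>_. r" I] by (simp add: I)
    ultimately show "C r \<in> lmeasurable" "measure lebesgue (C r) = r ^ dim V * measure lebesgue (C 1)"
      using measurable_stretch[OF C1, of m] measure_stretch[OF C1, of m] r by auto
  qed
  have "0 \<in> C 1"
    using linear_0[OF gP] by (simp add: C_def q_def infnorm_0)
  then have pos: "measure lebesgue (C 1) > 0"
    using openC[of 1] C1 negligible_iff_measure0 open_not_negligible by (metis empty_iff measure_nonneg less_eq_real_def)
  have q_diff: "infnorm (g (P a) - g (P b)) \<le> q a + q b" for a b
    using infnorm_triangle[of "g (P a)" "- g (P b)"] by (simp add: q_def infnorm_neg)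
  \<comment> \<open>Applying g after P to a common point of two translates exhibits
    \<open>v - w\<close> as a difference of two vectors of sup norm below \<rho>/2.\<close>
  have disj: "disjoint_family_on (\<lambda>v. (+) (f v) ` C (\<rho> / 2)) S"
  proof (unfold disjoint_family_on_def, intro ballI impI equals0I)
    fix v w y assume vw: "v \<in> S" "w \<in> S" "v \<noteq> w" and "y \<in> (+) (f v) ` C (\<rho> / 2) \<inter> (+) (f w) ` C (\<rho> / 2)"
    then obtain a b where ab: "a \<in> C (\<rho> / 2)" "b \<in> C (\<rho> / 2)" "f v + a = f w + b" by auto
    have "g (P (f v)) + g (P a) = g (P (f w)) + g (P b)"
      using ab(3) linear_add[OF gP] by metis
    then have "v - w = g (P b) - g (P a)"
      using qf[OF subsetD[OF S(2) vw(1)]] qf[OF subsetD[OF S(2) vw(2)]] by (simp add: algebra_simps)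
    then have "infnorm (v - w) \<le> q b + q a" using q_diff by metis
    also have "\<dots> < \<rho>" using ab by (simp add: C_def)
    finally show False using sep[of v w] vw by auto
  qed
  have sub: "(\<Union>v\<in>S. (+) (f v) ` C (\<rho> / 2)) \<subseteq> C (t + \<rho> / 2)"
  proof safe
    fix v a assume v: "v \<in> S" and a: "a \<in> C (\<rho> / 2)"
    have "q (f v + a) = infnorm (v + g (P a))"
      using v S qf by (auto simp: q_def linear_add[OF gP])
    also have "\<dots> \<le> infnorm v + q a" by (simp add: q_def infnorm_triangle)
    also have "\<dots> < t + \<rho> / 2" using bd[OF v] a by (simp add: C_def)
    finally have "q (f v + a) < t + \<rho> / 2" .
    \<comment> \<open>As \<open>f v\<close> is supported on \<open>I\<close>, translating by it
      leaves the thickened coordinates unchanged.\<close>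
    moreover have "f v \<in> T" using v S fg(3) by blast
    ultimately show "f v + a \<in> C (t + \<rho> / 2)"
      using a by (simp add: C_def T_def)
  qed
  have "(\<Sum>v\<in>S. measure lebesgue ((+) (f v) ` C (\<rho> / 2))) = measure lebesgue (\<Union>v\<in>S. (+) (f v) ` C (\<rho> / 2))"
    using Cr[of "\<rho> / 2"] \<open>0 < \<rho>\<close> S disj
    by (intro measure_finite_Union[symmetric]) (auto intro!: fmeasurableD measurable_translation fmeasurableD2)
  also have "\<dots> \<le> measure lebesgue (C (t + \<rho> / 2))"
    using Cr[of "\<rho> / 2"] Cr[of "t + \<rho> / 2"] \<open>0 < \<rho>\<close> \<open>0 \<le> t\<close> S
    by (intro measure_mono_fmeasurable sub) (auto intro!: sets.finite_UN fmeasurableD measurable_translation)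
  finally have "real (card S) * (\<rho> / 2) ^ dim V * measure lebesgue (C 1) \<le> (t + \<rho> / 2) ^ dim V * measure lebesgue (C 1)"
    using Cr(2)[of "\<rho> / 2"] Cr(2)[of "t + \<rho> / 2"] \<open>0 < \<rho>\<close> \<open>0 \<le> t\<close> by (simp add: measure_translation)
  then have "real (card S) * (\<rho> / 2) ^ dim V \<le> (t + \<rho> / 2) ^ dim V"
    using pos by simp
  moreover have "t + \<rho> / 2 = (1 + 2 * t / \<rho>) * (\<rho> / 2)" using \<open>0 < \<rho>\<close> by (simp add: field_simps)
  ultimately have "real (card S) * (\<rho> / 2) ^ dim V \<le> (1 + 2 * t / \<rho>) ^ dim V * (\<rho> / 2) ^ dim V"
    by (simp only: power_mult_distrib)
  then show ?thesis by (rule mult_right_le_imp_le) (use \<open>0 < \<rho>\<close> in simp)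
qed

section \<open>Exponential sums from counting bounds\<close>

lemma nn_integral_exp_atLeast: "(\<integral>\<^sup>+u. ennreal (exp (- u)) * indicator {a..} u \<partial>lborel) = ennreal (exp (- a))"
proof -
  have "(\<integral>\<^sup>+u. ennreal (exp (- u)) * indicator {a..} u \<partial>lborel) = ennreal (0 - (- exp (- a)))"
  proof (rule nn_integral_FTC_atLeast)
    show "((\<lambda>u::real. - exp (- u)) \<longlongrightarrow> 0) at_top"
      using tendsto_minus[OF filterlim_compose[OF exp_at_bot filterlim_uminus_at_bot_at_top]] by simp
  qed (auto intro!: derivative_eq_intros)
  then show ?thesis by simp
qed

text \<open>Layer cake: after factoring out exp (- \<delta> \<rho>), each term is the integral of
  exp (- u) over u \<ge> \<open>x v\<close>, so the sum becomes the integral of exp (- u) times a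
  counting function. The binomial theorem expands the counting bound, and the integral of u ^ j exp
  (- u) over u \<ge> 0 is j!.\<close>

lemma sum_exp_le_of_count:
  fixes N :: "'a \<Rightarrow> real" and \<rho> \<delta> :: real
  assumes S: "finite S" and "0 < \<rho>" "0 < \<delta>"
    and ge: "\<And>v. v \<in> S \<Longrightarrow> \<rho> \<le> N v"
    and count: "\<And>t. \<rho> \<le> t \<Longrightarrow> real (card {v \<in> S. N v \<le> t}) \<le> (1 + 2 * t / \<rho>) ^ d"
  shows "(\<Sum>v\<in>S. exp (- \<delta> * N v)) \<le>
    exp (- \<delta> * \<rho>) * (3 ^ d * (\<Sum>j\<le>d. real (d choose j) * fact j * (2 / (3 * \<rho> * \<delta>)) ^ j))"
proof -
  \<comment> \<open>Chosen so that at t = \<rho> + u / \<delta> the base 1 + 2 t / \<rho> equals 3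
    (1 + c u).\<close>
  define c where "c = 2 / (3 * \<rho> * \<delta>)"
  have c: "0 < c" using assms by (simp add: c_def)
  define x where "x v = \<delta> * (N v - \<rho>)" for v
  have pt: "(\<Sum>v\<in>S. ennreal (exp (- u)) * indicator {x v..} u)
      \<le> (\<Sum>j\<le>d. ennreal (3 ^ d * real (d choose j) * c ^ j) * (ennreal (u ^ j * exp (- u)) * indicator {0..} u))"
    (is "?L \<le> ?R") for u
  proof (cases "0 \<le> u")
    case True
    have "?L = ennreal (exp (- u)) * (\<Sum>v\<in>S. indicator {x v..} u)" by (simp add: sum_distrib_left)
    also have "(\<Sum>v\<in>S. indicator {x v..} u) = (\<Sum>v\<in>S. if N v \<le> \<rho> + u / \<delta> then 1 else 0 :: ennreal)"
      using \<open>0 < \<delta>\<close> by (intro sum.cong) (auto simp: x_def field_simps split: split_indicator)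
    also have "\<dots> = ennreal (real (card {v \<in> S. N v \<le> \<rho> + u / \<delta>}))"
      using S by (simp add: sum.If_cases Int_def ennreal_of_nat_eq_real_of_nat)
    also have "\<dots> \<le> ennreal ((1 + 2 * (\<rho> + u / \<delta>) / \<rho>) ^ d)"
      using count[of "\<rho> + u / \<delta>"] True \<open>0 < \<delta>\<close> by (intro ennreal_leI) simp
    also have "1 + 2 * (\<rho> + u / \<delta>) / \<rho> = 3 * (c * u + 1)"
      using assms by (simp add: c_def field_simps)
    also have "(3 * (c * u + 1)) ^ d = (\<Sum>j\<le>d. 3 ^ d * real (d choose j) * c ^ j * u ^ j)"
      unfolding power_mult_distrib[of 3] binomial_ring[of "c * u" 1]
      by (simp add: power_mult_distrib sum_distrib_left mult_ac)
    finally have "?L \<le> ennreal (exp (- u)) * ennreal (\<Sum>j\<le>d. 3 ^ d * real (d choose j) * c ^ j * u ^ j)"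
      by (simp add: mult_left_mono)
    also have "\<dots> = ennreal (\<Sum>j\<le>d. 3 ^ d * real (d choose j) * c ^ j * (u ^ j * exp (- u)))"
      using True c by (simp add: ennreal_mult[symmetric] sum_nonneg sum_distrib_left mult_ac)
    also have "\<dots> = ?R"
      using True c by (subst sum_ennreal[symmetric]) (auto simp: ennreal_mult intro!: sum.cong)
    finally show ?thesis .
  next
    case False
    \<comment> \<open>All thresholds are nonnegative because N \<ge> \<rho> on \<open>S\<close>, so
      nothing is counted at negative u.\<close>
    have "0 \<le> x v" if "v \<in> S" for v using ge[OF that] \<open>0 < \<delta>\<close> by (simp add: x_def)
    then have "?L = 0" using False by (force simp: sum_eq_0_iff S split: split_indicator)
    then show ?thesis by simp
  qed
  have "ennreal (\<Sum>v\<in>S. exp (- x v)) = (\<Sum>v\<in>S. \<integral>\<^sup>+u. ennreal (exp (- u)) * indicator {x v..} u \<partial>lborel)"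
    by (simp add: nn_integral_exp_atLeast sum_ennreal)
  also have "\<dots> = (\<integral>\<^sup>+u. (\<Sum>v\<in>S. ennreal (exp (- u)) * indicator {x v..} u) \<partial>lborel)"
    by (rule nn_integral_sum[symmetric]) auto
  also have "\<dots> \<le> (\<integral>\<^sup>+u. (\<Sum>j\<le>d. ennreal (3 ^ d * real (d choose j) * c ^ j) *
      (ennreal (u ^ j * exp (- u)) * indicator {0..} u)) \<partial>lborel)"
    by (intro nn_integral_mono pt)
  also have "\<dots> = (\<Sum>j\<le>d. ennreal (3 ^ d * real (d choose j) * c ^ j) * ennreal (fact j))"
    by (subst nn_integral_sum) (auto simp: nn_integral_cmult nn_intergal_power_times_exp_Ici)
  also have "\<dots> = ennreal (\<Sum>j\<le>d. 3 ^ d * real (d choose j) * c ^ j * fact j)"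
    using c by (simp add: ennreal_mult[symmetric] sum_ennreal)
  finally have "(\<Sum>v\<in>S. exp (- x v)) \<le> (\<Sum>j\<le>d. 3 ^ d * real (d choose j) * c ^ j * fact j)"
    using c by (subst (asm) ennreal_le_iff) (auto intro!: sum_nonneg)
  then have "exp (- \<delta> * \<rho>) * (\<Sum>v\<in>S. exp (- x v)) \<le> exp (- \<delta> * \<rho>) * (\<Sum>j\<le>d. 3 ^ d * real (d choose j) * c ^ j * fact j)"
    by simp
  moreover have "exp (- \<delta> * N v) = exp (- \<delta> * \<rho>) * exp (- x v)" for v
    by (simp add: x_def exp_add[symmetric] algebra_simps)
  ultimately show ?thesis by (simp add: sum_distrib_left mult_ac c_def)
qed

text \<open>Binomial coefficient times j! is a falling factorial, at most d ^ j, so each of the d +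
  1 terms is at most (d c) ^ j \<le> 1.\<close>

lemma sum_binomial_fact_le:
  fixes c :: real
  assumes "0 \<le> c" "real d * c \<le> 1"
  shows "(\<Sum>j\<le>d. real (d choose j) * fact j * c ^ j) \<le> real d + 1"
proof -
  have "real (d choose j) * fact j * c ^ j \<le> 1" if "j \<le> d" for j
  proof -
    have "(d choose j) * fact j \<le> d ^ j"
      using binomial_fact_pow[of d j] by simp
    then have "real (d choose j) * fact j \<le> real d ^ j"
      by (metis of_nat_fact of_nat_le_iff of_nat_mult of_nat_power)
    then have "real (d choose j) * fact j * c ^ j \<le> (real d * c) ^ j"
      using assms by (simp add: power_mult_distrib mult_right_mono)
    also have "\<dots> \<le> 1" using assms by (intro power_le_one) auto
    finally show ?thesis .
  qed
  then have "(\<Sum>j\<le>d. real (d choose j) * fact j * c ^ j) \<le> (\<Sum>j\<le>d. 1)" by (intro sum_mono) auto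
  then show ?thesis by simp
qed

section \<open>Characters and integration on the torus\<close>

text \<open>On the torus these Laurent monomials are the characters; the same expression is also
  evaluated on the annulus, where its modulus varies.\<close>

definition torus_char :: "int ^ 'n \<Rightarrow> complex ^ 'n \<Rightarrow> complex" where
  "torus_char v z = (\<Prod>i\<in>UNIV. (z $ i) powi (v $ i))"

lemma torus_nonzero: "z \<in> torus \<Longrightarrow> z $ i \<noteq> 0"
  by (auto simp: torus_def) (metis norm_zero zero_neq_one)

lemma torus_char_0 [simp]: "torus_char 0 z = 1"
  by (simp add: torus_char_def)

lemma torus_char_add: "z \<in> torus \<Longrightarrow> torus_char (u + v) z = torus_char u z * torus_char v z"
  by (simp add: torus_char_def power_int_add torus_nonzero prod.distrib)

lemma torus_char_mult: "torus_char v (w * z) = torus_char v w * torus_char v z"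
  by (simp add: torus_char_def vec_times_nth power_int_mult_distrib prod.distrib)

lemma norm_torus_char: "z \<in> torus \<Longrightarrow> norm (torus_char v z) = 1"
  by (simp add: torus_char_def torus_def prod_norm[symmetric] norm_power_int)

lemma continuous_on_torus_char [continuous_intros]: "continuous_on torus (torus_char v)"
  unfolding torus_char_def by (intro continuous_intros ballI) (simp add: torus_nonzero)

lemma torus_char_axis: "torus_char (axis i k) z = (z $ i) powi k"
  unfolding torus_char_def axis_def by (simp add: if_distrib[of "\<lambda>k. _ powi k"] prod.If_cases flip: power_int_def cong: if_cong)

text \<open>Lets compactness of the torus follow from \<open>compact_annulus\<close>.\<close>

lemma torus_eq_annulus: "torus = annulus 0"
proof (intro equalityI subsetI)
  fix z :: "complex ^ 'a" assume z: "z \<in> annulus 0"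
  have "cmod (z $ i) = 1" for i
  proof -
    have "\<bar>ln (cmod (z $ i))\<bar> \<le> (\<Sum>i\<in>UNIV. \<bar>ln (cmod (z $ i))\<bar>)" by (rule member_le_sum) auto
    also have "\<dots> \<le> 0" using z by (simp add: annulus_def)
    finally have "ln (cmod (z $ i)) = 0" by linarith
    moreover have "0 < cmod (z $ i)" using z by (simp add: annulus_def)
    ultimately show ?thesis by (metis exp_ln exp_zero)
  qed
  then show "z \<in> torus" by (simp add: torus_def)
qed (simp add: annulus_def torus_nonzero, simp add: torus_def)

lemma compact_torus: "compact (torus :: (complex ^ 'n) set)"
  unfolding torus_eq_annulus by (rule compact_annulus)

text \<open>A common setting for \<open>haar_torus\<close> and \<open>haar_push A\<close>, so that
  integration facts are proved once for both.\<close>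

definition torus_prob :: "(complex ^ 'n) measure \<Rightarrow> bool" where
  "torus_prob \<nu> \<longleftrightarrow> prob_space \<nu> \<and> sets \<nu> = sets torus_borel"

lemma prob_space_haar_torus: "prob_space haar_torus"
  by (rule haar_prob_haar_torus[unfolded haar_prob_def, THEN conjunct2, THEN conjunct1])

lemma sets_haar_torus: "sets haar_torus = sets torus_borel"
  by (rule haar_prob_haar_torus[unfolded haar_prob_def, THEN conjunct1])

lemma distr_haar_torus: "w \<in> torus \<Longrightarrow> distr haar_torus haar_torus (\<lambda>z. w * z) = haar_torus"
  by (rule haar_prob_haar_torus[unfolded haar_prob_def, THEN conjunct2, THEN conjunct2, THEN bspec])

lemma torus_prob_haar: "torus_prob haar_torus"
  by (simp add: torus_prob_def prob_space_haar_torus sets_haar_torus)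

lemma measurable_haar_torus_translate:
  assumes "w \<in> torus"
  shows "(\<lambda>z. w * z) \<in> haar_torus \<rightarrow>\<^sub>M haar_torus"
proof -
  have "w \<in> space torus_borel" using assms by (simp add: space_restrict_space)
  from measurable_compose[OF measurable_Pair1'[OF this] measurable_torus_times]
  show ?thesis by (simp add: sets_haar_torus cong: measurable_cong_sets)
qed

lemma space_torus_prob: "torus_prob \<nu> \<Longrightarrow> space \<nu> = torus"
  using sets_eq_imp_space_eq[of \<nu> torus_borel] by (simp add: torus_prob_def space_restrict_space)

lemma borel_measurable_torus_prob:
  assumes "torus_prob \<nu>" "continuous_on torus h"
  shows "h \<in> borel_measurable \<nu>"
  using assms borel_measurable_continuous_on_restrict[of torus h]
  by (simp add: torus_prob_def cong: measurable_cong_sets)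

lemma continuous_on_torus_bounded:
  fixes h :: "complex ^ 'n \<Rightarrow> 'b :: real_normed_vector"
  assumes "continuous_on torus h"
  obtains B where "0 < B" "\<And>z. z \<in> torus \<Longrightarrow> norm (h z) \<le> B"
  using compact_imp_bounded[OF compact_continuous_image[OF assms compact_torus]]
  unfolding bounded_pos by auto

lemma integrable_torus_prob:
  fixes h :: "complex ^ 'n \<Rightarrow> 'b :: {banach, second_countable_topology}"
  assumes \<nu>: "torus_prob \<nu>" and h: "continuous_on torus h"
  shows "integrable \<nu> h"
proof -
  interpret prob_space \<nu> using \<nu> by (simp add: torus_prob_def)
  obtain B where "\<And>z. z \<in> torus \<Longrightarrow> norm (h z) \<le> B"
    using continuous_on_torus_bounded[OF h] by metis
  then show ?thesis
    by (intro integrable_const_bound[of _ B] borel_measurable_torus_prob[OF \<nu> h]) (auto simp: space_torus_prob[OF \<nu>])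
qed

lemma norm_integral_torus_le:
  fixes h :: "complex ^ 'n \<Rightarrow> 'b :: {banach, second_countable_topology}"
  assumes \<nu>: "torus_prob \<nu>" and h: "continuous_on torus h" and B: "\<And>z. z \<in> torus \<Longrightarrow> norm (h z) \<le> B"
  shows "norm (integral\<^sup>L \<nu> h) \<le> B"
proof -
  interpret prob_space \<nu> using \<nu> by (simp add: torus_prob_def)
  have "norm (integral\<^sup>L \<nu> h) \<le> (\<integral>z. norm (h z) \<partial>\<nu>)" by (rule integral_norm_bound)
  also have "\<dots> \<le> B"
    using B by (intro integral_le_const integrable_torus_prob[OF \<nu>] continuous_intros h)
      (auto simp: space_torus_prob[OF \<nu>])
  finally show ?thesis .
qed

lemma haar_torus_translate:
  fixes h :: "complex ^ 'n \<Rightarrow> 'b :: {banach, second_countable_topology}"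
  assumes w: "w \<in> torus" and h: "continuous_on torus h"
  shows "(\<integral>z. h (w * z) \<partial>haar_torus) = integral\<^sup>L haar_torus h"
proof -
  show ?thesis
    using integral_distr[OF measurable_haar_torus_translate[OF w] borel_measurable_torus_prob[OF torus_prob_haar h]]
    by (simp add: distr_haar_torus[OF w])
qed

text \<open>For nonzero \<open>v\<close> there is a torus point \<open>w\<close>, nontrivial only in
  a coordinate with \<open>v $ i\<close> nonzero, at which the character equals -1. Invariance under
  translation by \<open>w\<close> makes the integral its own negative.\<close>

lemma integral_torus_char:
  "(\<integral>z. torus_char v z \<partial>haar_torus) = (if v = 0 then 1 else 0)"
proof (cases "v = 0")
  case True
  interpret prob_space "haar_torus :: (complex ^ 'a) measure"
    by (rule prob_space_haar_torus)
  show ?thesis using True by (simp add: prob_space)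
next
  case False
  then obtain i where i: "v $ i \<noteq> 0" by (auto simp: vec_eq_iff)
  define w :: "complex ^ 'a" where "w = (\<chi> j. if j = i then cis (pi / v $ i) else 1)"
  have w: "w \<in> torus" by (simp add: w_def torus_def)
  have "torus_char v w = cis (pi / v $ i) powi (v $ i)"
    unfolding torus_char_def w_def by (simp add: if_distrib[of "\<lambda>x. x powi _"] prod.If_cases cong: if_cong)
  also have "\<dots> = -1" using i by (simp add: cis_power_int)
  finally have "(\<integral>z. torus_char v (w * z) \<partial>haar_torus) = - (\<integral>z. torus_char v z \<partial>haar_torus)"
    by (simp add: torus_char_mult)
  then show ?thesis using False haar_torus_translate[OF w continuous_on_torus_char, of v] by simp
qed

section \<open>Characters under the push-forward measure\<close>

lemma torus_prob_haar_push: "torus_prob (haar_push A)"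
proof -
  interpret prob_space "haar_torus :: (complex ^ 'b) measure"
    by (rule prob_space_haar_torus)
  have "torus_hom A \<in> haar_torus \<rightarrow>\<^sub>M torus_borel"
    using measurable_torus_hom[of A] by (simp add: sets_haar_torus cong: measurable_cong_sets)
  then show ?thesis by (simp add: torus_prob_def haar_push_def prob_space_distr)
qed

lemma power_int_prod: "(\<Prod>i\<in>S. f i) powi k = (\<Prod>i\<in>S. f i powi k)" for f :: "'a \<Rightarrow> 'b :: field"
  by (induction S rule: infinite_finite_induct) (auto simp: power_int_mult_distrib)

lemma power_int_sum:
  fixes x :: "'b :: field"
  assumes "x \<noteq> 0"
  shows "x powi (\<Sum>i\<in>S. k i) = (\<Prod>i\<in>S. x powi k i)"
  using assms by (induction S rule: infinite_finite_induct) (auto simp: power_int_add)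

text \<open>Duality: pulling a character back along the homomorphism acts on exponents by
  \<open>A\<close>, which is an interchange of the two finite products.\<close>

lemma torus_char_torus_hom:
  assumes "z \<in> torus"
  shows "torus_char v (torus_hom A z) = torus_char (A *v v) z"
proof -
  have "torus_char v (torus_hom A z) = (\<Prod>j\<in>UNIV. \<Prod>i\<in>UNIV. z $ i powi (A $ i $ j * v $ j))"
    by (simp add: torus_char_def torus_hom_def power_int_prod power_int_mult)
  also have "\<dots> = (\<Prod>i\<in>UNIV. \<Prod>j\<in>UNIV. z $ i powi (A $ i $ j * v $ j))"
    by (rule prod.swap)
  also have "\<dots> = torus_char (A *v v) z"
    by (simp add: torus_char_def matrix_vector_mult_def power_int_sum torus_nonzero[OF assms])
  finally show ?thesis .
qed

lemma integral_haar_push_torus_char: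
  "(\<integral>z. torus_char v z \<partial>haar_push A) = (if A *v v = 0 then 1 else 0)"
proof -
  have m: "torus_hom A \<in> haar_torus \<rightarrow>\<^sub>M torus_borel"
    using measurable_torus_hom[of A] by (simp add: sets_haar_torus cong: measurable_cong_sets)
  have "(\<integral>z. torus_char v z \<partial>haar_push A) = (\<integral>z. torus_char v (torus_hom A z) \<partial>haar_torus)"
    unfolding haar_push_def
    by (intro integral_distr m borel_measurable_continuous_on_restrict continuous_on_torus_char)
  also have "\<dots> = (\<integral>z. torus_char (A *v v) z \<partial>haar_torus)"
    by (intro Bochner_Integration.integral_cong refl)
      (simp add: space_torus_prob[OF torus_prob_haar] torus_char_torus_hom)
  finally show ?thesis by (simp add: integral_torus_char)
qed

text \<open>The factor \<open>torus_char (- v)\<close> is the conjugate character on the torus.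
  Written as a Laurent monomial it stays holomorphic off the torus, so the circles of integration
  can be moved.\<close>

definition fourier_coeff :: "(complex ^ 'n \<Rightarrow> complex) \<Rightarrow> int ^ 'n \<Rightarrow> complex" where
  "fourier_coeff h v = (\<integral>z. h z * torus_char (- v) z \<partial>haar_torus)"

text \<open>Haar measure has full support. By invariance, for each \<open>w\<close> in a countable
  dense set, h (w x) = 0 for almost every x. Countability gives one x that serves all these
  \<open>w\<close>, and continuity in \<open>w\<close> extends the vanishing to the whole torus, on
  which w x takes every value.\<close>

lemma AE_haar_torus_imp_zero:
  fixes h :: "complex ^ 'n \<Rightarrow> 'b :: real_normed_vector"
  assumes h: "continuous_on torus h" and ae: "AE z in haar_torus. h z = 0" and z: "z \<in> torus"
  shows "h z = 0"
proof -
  interpret prob_space "haar_torus :: (complex ^ 'n) measure"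
    by (rule prob_space_haar_torus)
  have sp: "space (haar_torus :: (complex ^ 'n) measure) = torus"
    by (rule space_torus_prob[OF torus_prob_haar])
  obtain D :: "(complex ^ 'n) set" where D: "countable D" "D \<subseteq> torus" "torus \<subseteq> closure D"
    using separable by metis
  have cD: "closure D \<subseteq> torus" using D(2) compact_imp_closed[OF compact_torus] by (rule closure_minimal)
  have "AE x in haar_torus. h (w * x) = 0" if w: "w \<in> D" for w
  proof -
    have w': "w \<in> torus" using w D by auto
    have "{x \<in> torus. h x = 0} \<in> sets torus_borel"
      using continuous_closedin_preimage_constant[OF h, of 0] compact_imp_closed[OF compact_torus]
      by (subst sets_restrict_space_iff) (auto intro: borel_closed closedin_closed_trans)
    then have "{x \<in> space haar_torus. h x = 0} \<in> sets haar_torus" by (simp add: sets_haar_torus sp)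
    from AE_distr_iff[OF measurable_haar_torus_translate[OF w'] this] ae show ?thesis
      unfolding distr_haar_torus[OF w'] by blast
  qed
  then have ae': "AE x in haar_torus. \<forall>w\<in>D. h (w * x) = 0"
    by (simp add: AE_ball_countable[OF D(1)])
  have "\<exists>x \<in> torus. \<forall>w\<in>D. h (w * x) = 0"
  proof (rule ccontr)
    assume no: "\<not> ?thesis"
    have "AE x in (haar_torus :: (complex ^ 'n) measure). False"
      using ae' AE_space by eventually_elim (use no in \<open>auto simp: sp\<close>)
    then show False by simp
  qed
  then obtain x where x: "x \<in> torus" "\<And>w. w \<in> D \<Longrightarrow> h (w * x) = 0" by blast
  have cont: "continuous_on (closure D) (\<lambda>w. h (w * x))"
    using x cD by (intro continuous_on_compose2[OF h] continuous_intros) (auto intro: torus_times_closed)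
  define w where "w = (\<chi> i. z $ i / x $ i)"
  have w: "w \<in> torus" using z x by (simp add: w_def torus_def norm_divide)
  have wx: "w * x = z" using torus_nonzero[OF x(1)] by (simp add: w_def vec_eq_iff vec_times_nth)
  have "h (w * x) = 0"
    using continuous_constant_on_closure[OF cont, of 0 w] x(2) w D(3) by auto
  then show ?thesis by (simp add: wx)
qed

section \<open>Uniqueness of Fourier coefficients\<close>

text \<open>Continuity is included so that the class is closed under sums, scalars and
  multiplication by characters, which drives the induction over polynomials.\<close>

definition orth_chars :: "(complex ^ 'n \<Rightarrow> complex) \<Rightarrow> bool" where
  "orth_chars h \<longleftrightarrow> continuous_on torus h \<and> (\<forall>v. (\<integral>z. h z * torus_char v z \<partial>haar_torus) = 0)"

lemma orth_chars_cong:
  assumes "orth_chars g" "\<And>z. z \<in> torus \<Longrightarrow> g z = h z"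
  shows "orth_chars h"
proof -
  have "(\<integral>z. h z * torus_char v z \<partial>haar_torus) = (\<integral>z. g z * torus_char v z \<partial>haar_torus)" for v
    using assms by (intro Bochner_Integration.integral_cong refl) (simp add: space_torus_prob[OF torus_prob_haar])
  moreover have "continuous_on torus h"
    using assms continuous_on_cong[of torus torus g h] by (simp add: orth_chars_def)
  ultimately show ?thesis using assms(1) by (simp add: orth_chars_def)
qed

lemma orth_chars_0: "orth_chars (\<lambda>z. 0)"
  by (simp add: orth_chars_def)

lemma orth_chars_add:
  assumes "orth_chars g" "orth_chars h"
  shows "orth_chars (\<lambda>z. g z + h z)"
  using assms
  by (auto simp: orth_chars_def distrib_right intro!: continuous_intros)
    (subst Bochner_Integration.integral_add; auto intro!: integrable_torus_prob[OF torus_prob_haar] continuous_intros)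

lemma orth_chars_cmult: "orth_chars h \<Longrightarrow> orth_chars (\<lambda>z. c * h z)"
  by (auto simp: orth_chars_def mult.assoc intro!: continuous_intros)

lemma orth_chars_sum: "(\<And>i. i \<in> S \<Longrightarrow> orth_chars (h i)) \<Longrightarrow> orth_chars (\<lambda>z. \<Sum>i\<in>S. h i z)"
  by (induction S rule: infinite_finite_induct) (auto simp: orth_chars_0 orth_chars_add)

lemma orth_chars_mult_char:
  assumes "orth_chars h"
  shows "orth_chars (\<lambda>z. h z * torus_char u z)"
proof -
  have "(\<integral>z. h z * torus_char u z * torus_char v z \<partial>haar_torus) = (\<integral>z. h z * torus_char (u + v) z \<partial>haar_torus)" for v
    by (intro Bochner_Integration.integral_cong refl)
      (simp add: space_torus_prob[OF torus_prob_haar] torus_char_add)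
  then show ?thesis using assms by (auto simp: orth_chars_def intro!: continuous_intros)
qed

text \<open>On the torus 1 / z_i is the conjugate of z_i, so each real coordinate function is a
  combination of the characters z_i and 1 / z_i.\<close>

lemma orth_chars_mult_inner_Basis:
  assumes h: "orth_chars h" and b: "b \<in> Basis"
  shows "orth_chars (\<lambda>z. h z * complex_of_real (z \<bullet> b))"
proof -
  obtain i u where b: "b = axis i u" using b by (auto simp: Basis_vec_def)
  have "orth_chars (\<lambda>z. (cnj u / 2) * (h z * torus_char (axis i 1) z) + (u / 2) * (h z * torus_char (axis i (-1)) z))"
    by (intro orth_chars_add orth_chars_cmult orth_chars_mult_char h)
  then show ?thesis
  proof (rule orth_chars_cong)
    fix z :: "complex ^ 'a" assume z: "z \<in> torus"
    have "inverse (z $ i) = cnj (z $ i)"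
      using z by (simp add: torus_def inverse_complex_def complex_eq_iff cmod_def power2_eq_square)
    moreover have "complex_of_real (z \<bullet> b) = (z $ i * cnj u + cnj (z $ i) * u) / 2"
      by (simp add: b inner_axis inner_complex_def complex_eq_iff)
    ultimately show "(cnj u / 2) * (h z * torus_char (axis i 1) z) + (u / 2) * (h z * torus_char (axis i (-1)) z)
        = h z * complex_of_real (z \<bullet> b)"
      by (simp add: torus_char_axis power_int_minus field_simps)
  qed
qed

text \<open>Linear functions reduce to coordinates. For a product the two factors are applied one
  after the other, hence the generalisation over \<open>h\<close>.\<close>

lemma orth_chars_mult_polynomial:
  assumes "real_polynomial_function p" "orth_chars h"
  shows "orth_chars (\<lambda>z. h z * complex_of_real (p z))"
  using assms
proof (induction arbitrary: h rule: real_polynomial_function.induct)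
  case (linear p)
  have "orth_chars (\<lambda>z. \<Sum>b\<in>Basis. complex_of_real (p b) * (h z * complex_of_real (z \<bullet> b)))"
    by (intro orth_chars_sum orth_chars_cmult orth_chars_mult_inner_Basis linear)
  moreover have "h z * complex_of_real (p z) = (\<Sum>b\<in>Basis. complex_of_real (p b) * (h z * complex_of_real (z \<bullet> b)))" for z
  proof -
    have "p z = p (\<Sum>b\<in>Basis. (z \<bullet> b) *\<^sub>R b)" by (simp add: euclidean_representation)
    also have "\<dots> = (\<Sum>b\<in>Basis. (z \<bullet> b) * p b)"
      using linear(1)[THEN bounded_linear.linear] by (simp add: linear_sum linear_cmul)
    finally show ?thesis by (simp add: sum_distrib_left mult_ac)
  qed
  ultimately show ?case by simp
next
  case (const c)
  then show ?case using orth_chars_cmult[of h "complex_of_real c"] by (simp add: mult.commute)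
next
  case (add p q)
  then show ?case using orth_chars_add[OF add.IH] by (simp add: distrib_left)
next
  case (mult p q)
  then show ?case using mult.IH(2)[OF mult.IH(1)] by (simp add: mult.assoc)
qed

text \<open>By Stone-Weierstrass \<open>h\<close> is orthogonal to every continuous real function,
  in particular to its own real and imaginary parts. So the integral of \<bar>h\<bar>^2 is 0, and
  full support of Haar measure finishes.\<close>

lemma orth_chars_imp_zero:
  assumes h: "orth_chars h" and z: "z \<in> torus"
  shows "h z = 0"
proof -
  note haar = torus_prob_haar
  have ch: "continuous_on torus h" using h by (simp add: orth_chars_def)
  obtain B where B: "0 < B" "\<And>z. z \<in> torus \<Longrightarrow> norm (h z) \<le> B"
    using continuous_on_torus_bounded[OF ch] by blast
  have zero: "(\<integral>z. h z * complex_of_real (p z) \<partial>haar_torus) = 0" if "real_polynomial_function p" for p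
    using orth_chars_mult_polynomial[OF that h, unfolded orth_chars_def, THEN conjunct2, THEN spec[of _ 0]] by simp
  have zero': "(\<integral>z. h z * complex_of_real (k z) \<partial>haar_torus) = 0" if k: "continuous_on torus k" for k :: "complex ^ 'a \<Rightarrow> real"
  proof -
    have "norm (\<integral>z. h z * complex_of_real (k z) \<partial>haar_torus) \<le> 0 + e" if e: "0 < e" for e
    proof -
      obtain p where p: "real_polynomial_function p" "\<And>z. z \<in> torus \<Longrightarrow> \<bar>k z - p z\<bar> < e / B"
        using Stone_Weierstrass_real_polynomial_function[OF compact_torus k, of "e / B"] e B by auto
      have cp: "continuous_on torus p"
        using p(1) continuous_on_polymonial_function real_polynomial_function_eq by blast
      have "(\<integral>z. h z * complex_of_real (k z) \<partial>haar_torus) = (\<integral>z. h z * complex_of_real (k z - p z) \<partial>haar_torus)"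
        using zero[OF p(1)]
        by (simp add: right_diff_distrib) (subst Bochner_Integration.integral_diff; auto intro!: integrable_torus_prob[OF haar] continuous_intros ch k cp)
      also have "norm \<dots> \<le> B * (e / B)"
      proof (rule norm_integral_torus_le[OF haar])
        fix z :: "complex ^ 'a" assume "z \<in> torus"
        then show "norm (h z * complex_of_real (k z - p z)) \<le> B * (e / B)"
          using B p(2)[of z] unfolding norm_mult norm_of_real by (intro mult_mono) auto
      qed (intro continuous_intros ch k cp)
      finally show ?thesis using B by simp
    qed
    then have "norm (\<integral>z. h z * complex_of_real (k z) \<partial>haar_torus) \<le> 0" by (rule field_le_epsilon)
    then show ?thesis by simp
  qed
  \<comment> \<open>This is \<bar>h\<bar>^2 = h times its conjugate, with the conjugate split into
    real and imaginary parts.\<close>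
  have "(\<integral>z. complex_of_real ((norm (h z))\<^sup>2) \<partial>haar_torus)
      = (\<integral>z. h z * complex_of_real (Re (h z)) - \<i> * (h z * complex_of_real (Im (h z))) \<partial>haar_torus)"
    by (intro Bochner_Integration.integral_cong refl) (simp add: cmod_power2 complex_eq_iff flip: power2_eq_square)
  also have "\<dots> = 0"
    by (subst Bochner_Integration.integral_diff)
      (auto simp: zero'[OF continuous_on_Re[OF ch]] zero'[OF continuous_on_Im[OF ch]] intro!: integrable_torus_prob[OF haar] continuous_intros ch)
  finally have "(\<integral>z. (norm (h z))\<^sup>2 \<partial>haar_torus) = 0"
    by (simp only: integral_complex_of_real of_real_eq_0_iff)
  then have "AE z in haar_torus. (norm (h z))\<^sup>2 = 0"
    by (subst (asm) integral_nonneg_eq_0_iff_AE) (auto intro!: integrable_torus_prob[OF haar] continuous_intros ch)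
  then show ?thesis using AE_haar_torus_imp_zero[OF ch _ z] by simp
qed

lemma fourier_coeff_zero_imp_zero:
  assumes "continuous_on torus h" "\<And>v. fourier_coeff h v = 0" "z \<in> torus"
  shows "h z = 0"
proof -
  have "orth_chars h"
    using assms(1) assms(2)[of "- v" for v] by (simp add: orth_chars_def fourier_coeff_def)
  then show ?thesis using assms(3) by (rule orth_chars_imp_zero)
qed

section \<open>Decay of Fourier coefficients\<close>

text \<open>In the convex strip \<open>k\<close> has a primitive \<open>g\<close>. By periodicity g
  (s + 2 pi i) - g s has derivative 0, hence is a constant \<open>c\<close>, and the integral along
  every vertical segment of length 2 pi is - i c.\<close>

lemma integral_periodic_strip:
  fixes k :: "complex \<Rightarrow> complex"
  assumes k: "k holomorphic_on {s. \<bar>Re s\<bar> < \<delta>}" and per: "\<And>s. k (s + of_real (2 * pi) * \<i>) = k s"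
    and x: "\<bar>x\<bar> < \<delta>"
  shows "integral {0..2 * pi} (\<lambda>t. k (of_real x + of_real t * \<i>)) = integral {0..2 * pi} (\<lambda>t. k (of_real t * \<i>))"
proof -
  define S where "S = {s. \<bar>Re s\<bar> < \<delta>}"
  have S: "S = {s. Re s < \<delta>} \<inter> {s. Re s > - \<delta>}" by (auto simp: S_def)
  have "open S" unfolding S by (intro open_Int open_halfspace_Re_lt open_halfspace_Re_gt)
  have "convex S" unfolding S by (intro convex_Int convex_halfspace_Re_lt convex_halfspace_Re_gt)
  obtain g where g: "\<And>s. s \<in> S \<Longrightarrow> (g has_field_derivative k s) (at s within S)"
    using holomorphic_convex_primitive'[OF \<open>convex S\<close> \<open>open S\<close>] k unfolding S_def by blast
  then have g: "(g has_field_derivative k s) (at s)" if "s \<in> S" for s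
    using that at_within_open[OF that \<open>open S\<close>] by metis
  have "((\<lambda>s. g (s + of_real (2 * pi) * \<i>) - g s) has_field_derivative 0) (at s within S)" if "s \<in> S" for s
  proof -
    have "((\<lambda>s. g (s + of_real (2 * pi) * \<i>)) has_field_derivative k s) (at s)"
      using DERIV_shift[of g "k s" s "of_real (2 * pi) * \<i>"] g[of "s + of_real (2 * pi) * \<i>"] that per
      by (simp add: S_def)
    from DERIV_diff[OF this g[OF that]] show ?thesis by (simp add: has_field_derivative_at_within)
  qed
  then obtain c where c: "\<And>s. s \<in> S \<Longrightarrow> g (s + of_real (2 * pi) * \<i>) - g s = c"
    using has_field_derivative_zero_constant[OF \<open>convex S\<close>, of "\<lambda>s. g (s + of_real (2 * pi) * \<i>) - g s"] by auto
  have "integral {0..2 * pi} (\<lambda>t. k (of_real y + of_real t * \<i>)) = - \<i> * c" if y: "\<bar>y\<bar> < \<delta>" for y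
  proof -
    have "((\<lambda>t. \<i> * k (of_real y + of_real t * \<i>)) has_integral
        (g (of_real y + of_real (2 * pi) * \<i>) - g (of_real y + of_real 0 * \<i>))) {0..2 * pi}"
    proof (rule fundamental_theorem_of_calculus)
      fix t :: real
      have "((\<lambda>t. of_real y + of_real t * \<i>) has_vector_derivative \<i>) (at t)"
        by (auto intro!: derivative_eq_intros simp: has_vector_derivative_def scaleR_conv_of_real)
      moreover have "(g has_field_derivative k (of_real y + of_real t * \<i>)) (at (of_real y + of_real t * \<i>))"
        using y by (intro g) (simp add: S_def)
      ultimately have "(g \<circ> (\<lambda>t. of_real y + of_real t * \<i>) has_vector_derivative \<i> * k (of_real y + of_real t * \<i>)) (at t)"
        by (rule field_vector_diff_chain_at)
      then show "((\<lambda>t. g (of_real y + of_real t * \<i>)) has_vector_derivative \<i> * k (of_real y + of_real t * \<i>))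
          (at t within {0..2 * pi})"
        unfolding o_def by (rule has_vector_derivative_at_within)
    qed simp
    then have "((\<lambda>t. \<i> * k (of_real y + of_real t * \<i>)) has_integral c) {0..2 * pi}"
      using c[of "of_real y"] y by (simp add: S_def)
    from has_integral_mult_right[OF this, of "- \<i>"]
    show ?thesis by (intro integral_unique) (simp add: mult.assoc[symmetric])
  qed
  from this[OF x] this[of 0] x show ?thesis by simp
qed

text \<open>One complex parameter for both motions of coordinate \<open>i\<close>: the imaginary
  part of \<open>s\<close> rotates within the torus, the real part changes the radius.\<close>

definition dilation :: "'n \<Rightarrow> complex \<Rightarrow> complex ^ 'n" where
  "dilation i s = (\<chi> j. if j = i then exp s else 1)"

lemma dilation_add: "dilation i (s + t) = dilation i s * dilation i t"
  by (simp add: dilation_def vec_eq_iff vec_times_nth exp_add)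

lemma dilation_0: "dilation i 0 * z = z"
  by (simp add: dilation_def vec_eq_iff vec_times_nth)

lemma dilation_in_torus: "dilation i (of_real t * \<i>) \<in> torus"
  by (simp add: dilation_def torus_def)

lemma dilation_in_annulus:
  assumes "z \<in> torus" "\<bar>Re s\<bar> \<le> \<delta>"
  shows "dilation i s * z \<in> annulus \<delta>"
proof -
  have "\<bar>ln (cmod ((dilation i s * z) $ j))\<bar> = (if j = i then \<bar>Re s\<bar> else 0)" for j
    using assms by (simp add: dilation_def vec_times_nth norm_mult torus_def)
  then show ?thesis
    using assms torus_nonzero[OF assms(1)] by (simp add: annulus_def) (simp add: dilation_def vec_times_nth)
qed

lemma continuous_on_dilation [continuous_intros]:
  "continuous_on S s \<Longrightarrow> continuous_on S (\<lambda>x. dilation i (s x))"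
  unfolding dilation_def
proof (intro continuous_on_vec_lambda)
  fix j show "continuous_on S s \<Longrightarrow> continuous_on S (\<lambda>x. if j = i then exp (s x) else 1)"
    by (cases "j = i") (auto intro!: continuous_intros)
qed

lemma measurable_haar_torus_borel: "(\<lambda>z. z) \<in> haar_torus \<rightarrow>\<^sub>M borel"
proof -
  have "(\<lambda>z. z) \<in> torus_borel \<rightarrow>\<^sub>M borel" by (intro measurable_restrict_space1) simp
  then show ?thesis by (simp cong: measurable_cong_sets add: sets_haar_torus)
qed

text \<open>Averaging over imaginary \<open>s\<close> does not change the integral of \<open>F (dilation i s * z)\<close>, and
  after exchanging the order of integration the inner integral does not depend on the real part.\<close>

lemma haar_torus_dilation:
  fixes F :: "complex ^ 'n \<Rightarrow> complex"
  assumes F: "continuous_on (annulus \<delta>) F"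
    and hol: "\<And>z. z \<in> torus \<Longrightarrow> (\<lambda>s. F (dilation i s * z)) holomorphic_on {s. \<bar>Re s\<bar> < \<delta>}"
    and x: "\<bar>x\<bar> < \<delta>"
  shows "(\<integral>z. F (dilation i (of_real x) * z) \<partial>haar_torus) = integral\<^sup>L haar_torus F"
proof -
  define L where "L = restrict_space lborel {0..2 * pi}"
  have spL: "space L = {0..2 * pi}" by (simp add: L_def space_restrict_space)
  have mL: "emeasure L (space L) = ennreal (2 * pi)"
    unfolding spL by (simp add: L_def emeasure_restrict_space)
  interpret L: finite_measure L by (rule finite_measureI) (simp add: mL)
  interpret H: prob_space "haar_torus :: (complex ^ 'n) measure" by (rule prob_space_haar_torus)
  interpret HL: pair_sigma_finite "haar_torus :: (complex ^ 'n) measure" L ..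
  interpret P: finite_measure "(haar_torus :: (complex ^ 'n) measure) \<Otimes>\<^sub>M L"
    by (rule finite_measure_pair_measure) unfold_locales
  have spH: "space (haar_torus :: (complex ^ 'n) measure) = torus" by (rule space_torus_prob[OF torus_prob_haar])
  define K where "K y z = (\<integral>t. F (dilation i (of_real y + of_real t * \<i>) * z) \<partial>L)" for y z
  have ann: "dilation i (of_real y + of_real t * \<i>) * z \<in> annulus \<delta>" if "z \<in> torus" "\<bar>y\<bar> < \<delta>" for z y t
    using that by (intro dilation_in_annulus) auto
  have K: "K y z = integral {0..2 * pi} (\<lambda>t. F (dilation i (of_real y + of_real t * \<i>) * z))"
    if z: "z \<in> torus" and y: "\<bar>y\<bar> < \<delta>" for y z
  proof -
    have "continuous_on {0..2 * pi} (\<lambda>t. F (dilation i (of_real y + of_real t * \<i>) * z))"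
      using ann[OF z y] by (intro continuous_on_compose2[OF F] continuous_intros) auto
    from set_borel_integral_eq_integral(2)[OF borel_integrable_atLeastAtMost'[OF this]]
    show ?thesis
      by (simp add: K_def L_def integral_restrict_space set_lebesgue_integral_def)
  qed
  have "2 * pi * (\<integral>z. F (dilation i (of_real y) * z) \<partial>haar_torus) = (\<integral>z. K y z \<partial>haar_torus)"
    if y: "\<bar>y\<bar> < \<delta>" for y
  proof -
    define G where "G z t = F (dilation i (of_real y + of_real t * \<i>) * z)" for z t
    \<comment> \<open>\<open>F\<close> is controlled only on the annulus. Extending it by 0 gives a
      Borel function on the whole space, from which joint measurability of \<open>G\<close>
      follows.\<close>
    define F' where "F' z = indicator (annulus \<delta>) z *\<^sub>R F z" for z
    have cy: "continuous_on torus (\<lambda>z. F (dilation i (of_real y) * z))"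
      using ann[OF _ y, of _ 0] by (intro continuous_on_compose2[OF F] continuous_intros) auto
    have F': "F' \<in> borel_measurable borel"
      unfolding F'_def
      by (intro borel_measurable_continuous_on_indicator F borel_closed compact_imp_closed compact_annulus)
    have fst: "fst \<in> (haar_torus \<Otimes>\<^sub>M L) \<rightarrow>\<^sub>M (borel :: (complex ^ 'n) measure)"
      by (rule measurable_compose[OF measurable_fst measurable_haar_torus_borel])
    have "(\<lambda>t. t) \<in> L \<rightarrow>\<^sub>M borel" unfolding L_def by (intro measurable_restrict_space1) simp
    then have snd: "snd \<in> ((haar_torus :: (complex ^ 'n) measure) \<Otimes>\<^sub>M L) \<rightarrow>\<^sub>M borel"
      by (rule measurable_compose[OF measurable_snd])
    have "(\<lambda>p. dilation i (of_real y + of_real (snd p) * \<i>) * fst p) \<in> borel_measurable (borel :: ((complex ^ 'n) \<times> real) measure)"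
      by (intro borel_measurable_continuous_onI continuous_intros)
    from measurable_compose[OF measurable_Pair[OF fst snd, unfolded borel_prod] this]
    have "(\<lambda>p. F' (dilation i (of_real y + of_real (snd p) * \<i>) * fst p)) \<in> borel_measurable (haar_torus \<Otimes>\<^sub>M L)"
      by (intro measurable_compose[OF _ F']) simp
    moreover have "F' (dilation i (of_real y + of_real (snd p) * \<i>) * fst p) = case_prod G p"
      if "p \<in> space (haar_torus \<Otimes>\<^sub>M L)" for p
      using that ann[OF _ y] by (auto simp: space_pair_measure spH F'_def G_def)
    ultimately have mG: "case_prod G \<in> borel_measurable (haar_torus \<Otimes>\<^sub>M L)"
      by (simp cong: measurable_cong)
    obtain B where B: "\<And>z. z \<in> annulus \<delta> \<Longrightarrow> norm (F z) \<le> B"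
      using compact_imp_bounded[OF compact_continuous_image[OF F compact_annulus]] unfolding bounded_iff by auto
    have "integrable (haar_torus \<Otimes>\<^sub>M L) (case_prod G)"
      by (rule P.integrable_const_bound[OF _ mG, of B])
        (auto simp: space_pair_measure spH G_def intro!: AE_I2 B ann y)
    from HL.Fubini_integral[OF this]
    have "(\<integral>z. K y z \<partial>haar_torus) = (\<integral>t. \<integral>z. G z t \<partial>haar_torus \<partial>L)" by (simp add: K_def G_def)
    also have "\<dots> = (\<integral>t. (\<integral>z. F (dilation i (of_real y) * z) \<partial>haar_torus) \<partial>L)"
    proof (rule Bochner_Integration.integral_cong[OF refl])
      fix t
      have "G z t = F (dilation i (of_real y) * (dilation i (of_real t * \<i>) * z))" for z
        unfolding G_def dilation_add by (rule arg_cong[of _ _ F]) (simp add: vec_eq_iff vec_times_nth mult.assoc)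
      then show "(\<integral>z. G z t \<partial>haar_torus) = (\<integral>z. F (dilation i (of_real y) * z) \<partial>haar_torus)"
        using haar_torus_translate[OF dilation_in_torus cy] by simp
    qed
    also have "\<dots> = 2 * pi * (\<integral>z. F (dilation i (of_real y) * z) \<partial>haar_torus)"
      using mL by (simp add: measure_def scaleR_conv_of_real)
    finally show ?thesis by simp
  qed
  from this[OF x] this[of 0] x
  have "2 * pi * (\<integral>z. F (dilation i (of_real x) * z) \<partial>haar_torus) = (\<integral>z. K x z \<partial>haar_torus)"
    "2 * pi * integral\<^sup>L haar_torus F = (\<integral>z. K 0 z \<partial>haar_torus)"
    by (auto simp: dilation_0)
  moreover have "(\<integral>z. K x z \<partial>haar_torus) = (\<integral>z. K 0 z \<partial>haar_torus)"
  proof (intro Bochner_Integration.integral_cong refl)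
    fix z :: "complex ^ 'n" assume "z \<in> space haar_torus"
    then have z: "z \<in> torus" by (simp add: spH)
    have "dilation i (s + of_real (2 * pi) * \<i>) = dilation i s" for s
    proof -
      have "exp (s + of_real (2 * pi) * \<i>) = exp s" by (simp add: exp_add)
      then show ?thesis by (simp only: dilation_def)
    qed
    then show "K x z = K 0 z"
      using integral_periodic_strip[OF hol[OF z] _ x] x K[OF z x] K[OF z, of 0] by simp
  qed
  ultimately have "2 * pi * (\<integral>z. F (dilation i (of_real x) * z) \<partial>haar_torus) = 2 * pi * integral\<^sup>L haar_torus F"
    by (simp only:)
  then show ?thesis by (subst (asm) mult_cancel_left) simp
qed

text \<open>The dilated point is affine in exp s, so the chain rule applies; complex homogeneity of
  \<open>D\<close> turns the real derivative into multiplication by a complex number.\<close>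

lemma holomorphic_several_dilation:
  assumes f: "holomorphic_several f U" and s: "dilation i s * z \<in> U"
  shows "(\<lambda>s. f (dilation i s * z)) field_differentiable at s"
proof -
  define u where "u = axis i (z $ i)"
  have dil: "dilation i s * z = (z - u) + exp s *s u" for s
    by (auto simp: u_def dilation_def vec_eq_iff vec_times_nth axis_def)
  obtain D where D: "(f has_derivative D) (at (dilation i s * z))" "\<And>c v. D (c *s v) = c * D v"
    using f s unfolding holomorphic_several_def by blast
  have "linear (\<lambda>c. c *s u)"
    by (auto simp: linear_iff vec_eq_iff algebra_simps)
  then have bl: "bounded_linear (\<lambda>c. c *s u)" by (simp add: linear_conv_bounded_linear)
  have "(exp has_derivative (\<lambda>h. h * exp s)) (at s)"
    using DERIV_exp[of s] by (simp add: has_field_derivative_def mult_commute_abs)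
  from bounded_linear.has_derivative[OF bl this]
  have "((\<lambda>s. dilation i s * z) has_derivative (\<lambda>h. (h * exp s) *s u)) (at s)"
    unfolding dil using has_derivative_add[OF has_derivative_const[of "z - u"]] by fastforce
  from has_derivative_compose[OF this D(1)]
  have "((\<lambda>s. f (dilation i s * z)) has_derivative (\<lambda>h. h * (exp s * D u))) (at s)"
    by (simp add: D(2) mult.assoc)
  then show ?thesis
    unfolding field_differentiable_def has_field_derivative_def by (metis (no_types) mult_commute_abs)
qed

text \<open>Changing the radius of coordinate \<open>i\<close> to exp x leaves the integral
  unchanged, while the monomial contributes exp (- x \<open>v $ i\<close>). The sign of x is taken
  so that this factor decays.\<close>

lemma fourier_coeff_bound_component:
  fixes f :: "complex ^ 'n \<Rightarrow> complex"
  assumes f: "holomorphic_several f U" and ann: "annulus \<delta> \<subseteq> U" and "0 < \<delta>"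
    and M: "\<And>z. z \<in> annulus \<delta> \<Longrightarrow> norm (f z) \<le> M"
  shows "norm (fourier_coeff f v) \<le> M * exp (- \<delta> * \<bar>v $ i\<bar>)"
proof -
  define F where "F z = f z * torus_char (- v) z" for z
  have "1 \<in> (annulus \<delta> :: (complex ^ 'n) set)"
    using \<open>0 < \<delta>\<close> by (simp add: annulus_def one_vec_def)
  then have M0: "0 \<le> M" using M norm_ge_zero order_trans by blast
  have cf: "continuous_on (annulus \<delta>) f"
    using f ann by (intro continuous_at_imp_continuous_on ballI)
      (auto simp: holomorphic_several_def dest!: has_derivative_continuous)
  have cF: "continuous_on (annulus \<delta>) F"
    unfolding F_def torus_char_def by (intro continuous_intros cf ballI) (auto simp: annulus_def)
  have char: "torus_char (- v) (dilation i s) = exp (- of_int (v $ i) * s)" for s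
    unfolding torus_char_def dilation_def
    by (simp add: if_distrib[of "\<lambda>x. x powi _"] prod.If_cases exp_power_int cong: if_cong)
  have hol: "(\<lambda>s. F (dilation i s * z)) holomorphic_on {s. \<bar>Re s\<bar> < \<delta>}" if z: "z \<in> torus" for z
  proof -
    have "(\<lambda>s. f (dilation i s * z)) holomorphic_on {s. \<bar>Re s\<bar> < \<delta>}"
      unfolding holomorphic_on_def
    proof
      fix s assume "s \<in> {s. \<bar>Re s\<bar> < \<delta>}"
      then have "dilation i s * z \<in> U" using dilation_in_annulus[OF z, of s \<delta> i] ann by auto
      then show "(\<lambda>s. f (dilation i s * z)) field_differentiable at s within {s. \<bar>Re s\<bar> < \<delta>}"
        by (rule field_differentiable_at_within[OF holomorphic_several_dilation[OF f]])
    qed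
    then show ?thesis unfolding F_def torus_char_mult char by (intro holomorphic_intros)
  qed
  \<comment> \<open>The radius can be moved only inside the open strip, so the bound is shown for y
    < \<delta> and then y tends to \<delta>.\<close>
  have "norm (fourier_coeff f v) \<le> M * exp (- y * \<bar>v $ i\<bar>)" if y: "0 < y" "y < \<delta>" for y
  proof -
    define x where "x = y * sgn (real_of_int (v $ i))"
    have x: "\<bar>x\<bar> < \<delta>" using y \<open>0 < \<delta>\<close> by (auto simp: x_def sgn_if)
    have "fourier_coeff f v = integral\<^sup>L haar_torus F"
      by (simp add: fourier_coeff_def F_def[abs_def])
    also have "\<dots> = (\<integral>z. F (dilation i (of_real x) * z) \<partial>haar_torus)"
      by (rule haar_torus_dilation[OF cF hol x, symmetric])
    also have "norm \<dots> \<le> M * exp (- y * \<bar>v $ i\<bar>)"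
    proof (rule norm_integral_torus_le[OF torus_prob_haar])
      fix z :: "complex ^ 'n" assume z: "z \<in> torus"
      have "norm (F (dilation i (of_real x) * z)) = norm (f (dilation i (of_real x) * z)) * exp (- (v $ i * x))"
        by (simp add: F_def torus_char_mult char norm_mult norm_torus_char[OF z])
      also have "v $ i * x = y * \<bar>v $ i\<bar>" by (auto simp: x_def sgn_if)
      also have "norm (f (dilation i (of_real x) * z)) * exp (- (y * \<bar>v $ i\<bar>)) \<le> M * exp (- (y * \<bar>v $ i\<bar>))"
        using x z by (intro mult_right_mono M dilation_in_annulus) auto
      finally show "norm (F (dilation i (of_real x) * z)) \<le> M * exp (- y * \<bar>v $ i\<bar>)" by simp
    next
      show "continuous_on torus (\<lambda>z. F (dilation i (of_real x) * z))"
        using x by (intro continuous_on_compose2[OF cF] continuous_intros) (auto intro!: dilation_in_annulus)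
    qed
    finally show ?thesis .
  qed
  moreover have "((\<lambda>y. M * exp (- y * \<bar>v $ i\<bar>)) \<longlongrightarrow> M * exp (- \<delta> * \<bar>v $ i\<bar>)) (at_left \<delta>)"
    by (intro tendsto_intros)
  moreover have "\<forall>\<^sub>F y in at_left \<delta>. y \<in> {0<..<\<delta>}"
    using \<open>0 < \<delta>\<close> by (rule eventually_at_leftI[rotated]) auto
  ultimately show ?thesis
    by (intro tendsto_lowerbound[of _ _ "at_left \<delta>"]) (auto elim!: eventually_mono)
qed

section \<open>Fourier series and lattice sums\<close>

text \<open>The Weierstrass M-test makes the finite partial sums converge uniformly, so the limit is
  continuous, and against a probability measure uniform errors bound errors of integrals.\<close>

lemma integral_has_sum_torus:
  fixes h :: "'i \<Rightarrow> complex ^ 'n \<Rightarrow> complex"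
  assumes \<nu>: "torus_prob \<nu>" and b: "b summable_on UNIV"
    and h: "\<And>i. continuous_on torus (h i)" "\<And>i z. z \<in> torus \<Longrightarrow> norm (h i z) \<le> b i"
    and g: "\<And>z. z \<in> torus \<Longrightarrow> ((\<lambda>i. h i z) has_sum g z) UNIV"
  shows "continuous_on torus g" "((\<lambda>i. integral\<^sup>L \<nu> (h i)) has_sum integral\<^sup>L \<nu> g) UNIV"
proof -
  have ul: "uniform_limit torus (\<lambda>X z. \<Sum>i\<in>X. h i z) g (finite_subsets_at_top UNIV)"
    using Weierstrass_m_test_general'[of UNIV torus h b g] h(2) g b by blast
  show cg: "continuous_on torus g"
    by (rule uniform_limit_theorem[OF _ ul]) (auto intro!: always_eventually continuous_intros h)
  show "((\<lambda>i. integral\<^sup>L \<nu> (h i)) has_sum integral\<^sup>L \<nu> g) UNIV"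
    unfolding has_sum_def
  proof (rule tendstoI)
    fix e :: real assume e: "0 < e"
    then have "\<forall>\<^sub>F X in finite_subsets_at_top UNIV. \<forall>z\<in>torus. dist (\<Sum>i\<in>X. h i z) (g z) < e / 2"
      using uniform_limitD[OF ul, of "e / 2"] by simp
    then show "\<forall>\<^sub>F X in finite_subsets_at_top UNIV. dist (\<Sum>i\<in>X. integral\<^sup>L \<nu> (h i)) (integral\<^sup>L \<nu> g) < e"
    proof (rule eventually_mono)
      fix X assume X: "\<forall>z\<in>torus. dist (\<Sum>i\<in>X. h i z) (g z) < e / 2"
      have "(\<integral>z. (\<Sum>i\<in>X. h i z) \<partial>\<nu>) = (\<Sum>i\<in>X. integral\<^sup>L \<nu> (h i))"
        by (intro Bochner_Integration.integral_sum integrable_torus_prob[OF \<nu>] h)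
      then have "(\<Sum>i\<in>X. integral\<^sup>L \<nu> (h i)) - integral\<^sup>L \<nu> g = (\<integral>z. (\<Sum>i\<in>X. h i z) - g z \<partial>\<nu>)"
        by (subst Bochner_Integration.integral_diff)
          (auto intro!: integrable_torus_prob[OF \<nu>] continuous_intros h cg)
      also have "norm \<dots> \<le> e / 2"
        using X by (intro norm_integral_torus_le[OF \<nu>] continuous_intros h cg) (auto simp: dist_norm less_imp_le)
      finally show "dist (\<Sum>i\<in>X. integral\<^sup>L \<nu> (h i)) (integral\<^sup>L \<nu> g) < e"
        using e by (simp add: dist_norm)
    qed
  qed
qed

text \<open>The sum \<open>g\<close> of the series is continuous and, by termwise integration, has
  the same coefficients as \<open>f\<close>. Then f - g has only zero coefficients and
  vanishes.\<close>

lemma fourier_series_has_sum: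
  fixes f :: "complex ^ 'n \<Rightarrow> complex"
  assumes f: "continuous_on torus f" and summ: "(\<lambda>v. norm (fourier_coeff f v)) summable_on UNIV"
    and z: "z \<in> torus"
  shows "((\<lambda>v. fourier_coeff f v * torus_char v z) has_sum f z) UNIV"
proof -
  define a where "a = fourier_coeff f"
  note summ = summ[folded a_def]
  define g where "g z = (\<Sum>\<^sub>\<infinity>v. a v * torus_char v z)" for z
  have g: "((\<lambda>v. a v * torus_char v z) has_sum g z) UNIV" if "z \<in> torus" for z
  proof -
    have "(\<lambda>v. norm (a v * torus_char v z)) summable_on UNIV"
      using summ that by (simp add: norm_mult norm_torus_char)
    then show ?thesis unfolding g_def by (rule has_sum_infsum[OF abs_summable_summable])
  qed
  have cg: "continuous_on torus g"
    by (rule integral_has_sum_torus(1)[OF torus_prob_haar summ, where h = "\<lambda>v z. a v * torus_char v z"])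
      (auto intro!: continuous_intros g simp: norm_mult norm_torus_char)
  have coeff: "fourier_coeff g w = a w" for w
  proof -
    have "((\<lambda>v. \<integral>z. a v * torus_char v z * torus_char (- w) z \<partial>haar_torus)
        has_sum (\<integral>z. g z * torus_char (- w) z \<partial>haar_torus)) UNIV"
      by (rule integral_has_sum_torus(2)[OF torus_prob_haar summ])
        (auto intro!: continuous_intros has_sum_cmult_left g simp: norm_mult norm_torus_char)
    moreover have "(\<integral>z. a v * torus_char v z * torus_char (- w) z \<partial>haar_torus) = (if v = w then a w else 0)" for v
    proof -
      have "(\<integral>z. a v * torus_char v z * torus_char (- w) z \<partial>haar_torus) = (\<integral>z. a v * torus_char (v - w) z \<partial>haar_torus)"
        by (intro Bochner_Integration.integral_cong refl)
          (simp add: space_torus_prob[OF torus_prob_haar] torus_char_add[of _ v "- w", simplified])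
      then show ?thesis by (simp add: integral_torus_char)
    qed
    ultimately have "((\<lambda>v. if v = w then a w else 0) has_sum fourier_coeff g w) UNIV"
      by (simp add: fourier_coeff_def)
    moreover have "((\<lambda>v. if v = w then a w else 0) has_sum a w) UNIV"
      using has_sum_finite_neutralI[of "{w}" UNIV "\<lambda>v. if v = w then a w else 0"] by simp
    ultimately show ?thesis using has_sum_unique by blast
  qed
  have "fourier_coeff (\<lambda>z. f z - g z) w = fourier_coeff f w - fourier_coeff g w" for w
    unfolding fourier_coeff_def left_diff_distrib
    by (intro Bochner_Integration.integral_diff integrable_torus_prob[OF torus_prob_haar] continuous_intros f cg)
  then have "fourier_coeff (\<lambda>z. f z - g z) w = 0" for w by (simp add: coeff) (simp add: a_def)
  then have "f z - g z = 0"
    by (rule fourier_coeff_zero_imp_zero[OF continuous_on_diff[OF f cg] _ z])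
  then have "f z = g z" by simp
  then show ?thesis using g[OF z] unfolding a_def by (simp only:)
qed

text \<open>Reduces both measures to their values on characters, so that the two integrals can be
  compared term by term.\<close>

lemma integral_fourier_has_sum:
  assumes "torus_prob \<nu>" "continuous_on torus f" "(\<lambda>v. norm (fourier_coeff f v)) summable_on UNIV"
  shows "((\<lambda>v. fourier_coeff f v * (\<integral>z. torus_char v z \<partial>\<nu>)) has_sum integral\<^sup>L \<nu> f) UNIV"
proof -
  have "((\<lambda>v. \<integral>z. fourier_coeff f v * torus_char v z \<partial>\<nu>) has_sum integral\<^sup>L \<nu> f) UNIV"
    by (rule integral_has_sum_torus(2)[OF assms(1,3)])
      (auto intro!: continuous_intros fourier_series_has_sum assms simp: norm_mult norm_torus_char)
  then show ?thesis by simp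
qed

section \<open>Integer vectors and exponential sums over lattice points\<close>

definition real_vec :: "int ^ 'n \<Rightarrow> real ^ 'n" where
  "real_vec v = (\<chi> j. real_of_int (v $ j))"

lemma real_vec_diff: "real_vec (u - v) = real_vec u - real_vec v"
  by (simp add: real_vec_def vec_eq_iff)

lemma inj_real_vec: "inj real_vec"
  by (auto simp: inj_def real_vec_def vec_eq_iff)

lemma int_supnorm_attained: "\<exists>i. int (int_supnorm v) = \<bar>v $ i\<bar>"
proof -
  have "int_supnorm v \<in> range (\<lambda>j. nat \<bar>v $ j\<bar>)" unfolding int_supnorm_def by (rule Max_in) auto
  then show ?thesis by auto
qed

lemma component_le_int_supnorm: "\<bar>v $ i\<bar> \<le> int (int_supnorm v)"
proof -
  have "nat \<bar>v $ i\<bar> \<le> int_supnorm v" unfolding int_supnorm_def by (rule Max_ge) auto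
  then show ?thesis by simp
qed

lemma int_supnorm_pos: "v \<noteq> 0 \<Longrightarrow> 0 < int_supnorm v"
proof -
  assume "v \<noteq> 0"
  then obtain i where "v $ i \<noteq> 0" by (auto simp: vec_eq_iff)
  then show ?thesis using component_le_int_supnorm[of v i] by linarith
qed

lemma infnorm_real_vec: "infnorm (real_vec v) = real (int_supnorm v)"
proof (rule antisym)
  have "\<bar>real_vec v $ i\<bar> \<le> real (int_supnorm v)" for i
    using component_le_int_supnorm[of v i] by (simp add: real_vec_def)
  then show "infnorm (real_vec v) \<le> real (int_supnorm v)"
    unfolding infnorm_cart by (intro cSup_least) auto
  obtain i where "int (int_supnorm v) = \<bar>v $ i\<bar>" using int_supnorm_attained by blast
  then have "real (int_supnorm v) = \<bar>real_vec v $ i\<bar>"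
    by (simp add: real_vec_def)
  then show "real (int_supnorm v) \<le> infnorm (real_vec v)"
    using component_le_infnorm_cart[of "real_vec v" i] by simp
qed

text \<open>The packing bound supplies the count. Applied to the whole space with \<rho> = 1 it
  gives absolute convergence of the Fourier series; applied to \<open>real_ker A\<close> it gives
  the final estimate.\<close>

lemma sum_exp_int_supnorm_le:
  fixes \<delta> :: real and \<rho> :: nat
  assumes V: "subspace V" and S: "finite S" and "0 < \<rho>" "0 < \<delta>"
    and SV: "\<And>v. v \<in> S \<Longrightarrow> real_vec v \<in> V" and ge: "\<And>v. v \<in> S \<Longrightarrow> \<rho> \<le> int_supnorm v"
    and sep: "\<And>u v. u \<in> S \<Longrightarrow> v \<in> S \<Longrightarrow> u \<noteq> v \<Longrightarrow> \<rho> \<le> int_supnorm (u - v)"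
  shows "(\<Sum>v\<in>S. exp (- \<delta> * int_supnorm v)) \<le> exp (- \<delta> * \<rho>) *
    (3 ^ dim V * (\<Sum>j\<le>dim V. real (dim V choose j) * fact j * (2 / (3 * real \<rho> * \<delta>)) ^ j))"
proof (rule sum_exp_le_of_count[OF S])
  fix t :: real assume t: "real \<rho> \<le> t"
  have "real (card (real_vec ` {v \<in> S. int_supnorm v \<le> t})) \<le> (1 + 2 * t / real \<rho>) ^ dim V"
    using S SV t \<open>0 < \<rho>\<close>
    by (intro card_separated_le[OF V]) (auto simp: infnorm_real_vec real_vec_diff[symmetric] intro!: sep)
  then show "real (card {v \<in> S. int_supnorm v \<le> t}) \<le> (1 + 2 * t / real \<rho>) ^ dim V"
    by (simp add: card_image inj_on_subset[OF inj_real_vec])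
qed (use assms in auto)

lemma fourier_coeff_bound:
  fixes f :: "complex ^ 'n \<Rightarrow> complex"
  assumes "holomorphic_several f U" "annulus \<delta> \<subseteq> U" "0 < \<delta>" "\<And>z. z \<in> annulus \<delta> \<Longrightarrow> norm (f z) \<le> M"
  shows "norm (fourier_coeff f v) \<le> M * exp (- \<delta> * int_supnorm v)"
proof -
  obtain i where "int (int_supnorm v) = \<bar>v $ i\<bar>" using int_supnorm_attained by blast
  then have "real (int_supnorm v) = of_int \<bar>v $ i\<bar>" by (metis of_int_of_nat_eq)
  then show ?thesis using fourier_coeff_bound_component[OF assms, of v i] by simp
qed

lemma summable_fourier_coeff:
  fixes f :: "complex ^ 'n \<Rightarrow> complex"
  assumes f: "holomorphic_several f U" "annulus \<delta> \<subseteq> U" "0 < \<delta>" "\<And>z. z \<in> annulus \<delta> \<Longrightarrow> norm (f z) \<le> M"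
    and "0 \<le> M"
  shows "(\<lambda>v. norm (fourier_coeff f v)) summable_on UNIV"
proof -
  define C where "C = exp (- \<delta> * real 1) * (3 ^ dim (UNIV :: (real ^ 'n) set) *
    (\<Sum>j\<le>dim (UNIV :: (real ^ 'n) set). real (dim (UNIV :: (real ^ 'n) set) choose j) * fact j * (2 / (3 * real 1 * \<delta>)) ^ j))"
  \<comment> \<open>Distinct integer vectors have sup distance at least 1. The zero vector is left
    out because its norm is below 1, and it is added back at the end.\<close>
  have "(\<Sum>v\<in>F. norm (fourier_coeff f v)) \<le> M * C" if F: "finite F" "F \<subseteq> UNIV - {0}" for F
  proof -
    have "(\<Sum>v\<in>F. norm (fourier_coeff f v)) \<le> (\<Sum>v\<in>F. M * exp (- \<delta> * int_supnorm v))"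
      by (intro sum_mono fourier_coeff_bound[OF f])
    also have "\<dots> = M * (\<Sum>v\<in>F. exp (- \<delta> * int_supnorm v))" by (simp add: sum_distrib_left)
    also have "(\<Sum>v\<in>F. exp (- \<delta> * int_supnorm v)) \<le> C"
      unfolding C_def using F \<open>0 < \<delta>\<close>
      by (intro sum_exp_int_supnorm_le) (auto intro!: Suc_leI int_supnorm_pos)
    finally show ?thesis using \<open>0 \<le> M\<close> by (simp add: mult_left_mono)
  qed
  then have "(\<lambda>v. norm (fourier_coeff f v)) summable_on (UNIV - {0})"
    by (intro nonneg_bdd_above_summable_on bdd_aboveI2[of _ _ "M * C"]) auto
  then show ?thesis using summable_on_insert_iff[of "\<lambda>v. norm (fourier_coeff f v)" 0 "UNIV - {0}"] by (simp add: insert_UNIV)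
qed

section \<open>The integer kernel of \<open>A\<close> and comparison of the two integrals\<close>

lemma subspace_real_ker: "subspace (real_ker A)"
  unfolding real_ker_def by (simp add: subspace_def matrix_vector_right_distrib matrix_vector_mult_scaleR)

lemma real_vec_in_real_ker:
  assumes "A *v v = 0"
  shows "real_vec v \<in> real_ker A"
proof -
  have "(\<Sum>j\<in>UNIV. A $ i $ j * v $ j) = 0" for i
    using assms by (simp add: matrix_vector_mult_def vec_eq_iff)
  then have "real_of_int (\<Sum>j\<in>UNIV. A $ i $ j * v $ j) = 0" for i by simp
  then show ?thesis by (simp add: real_ker_def real_vec_def matrix_vector_mult_def vec_eq_iff)
qed

lemma rho_le_int_supnorm: "v \<noteq> 0 \<Longrightarrow> A *v v = 0 \<Longrightarrow> rho A \<le> enat (int_supnorm v)"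
  unfolding rho_def by (rule Inf_lower) auto

lemma rho_pos: "0 < rho A"
proof -
  have "enat 1 \<le> rho A"
    unfolding rho_def by (rule Inf_greatest) (auto intro!: Suc_leI int_supnorm_pos)
  then show ?thesis by (metis enat_ord_simps(2) less_le_trans zero_enat_def zero_less_one)
qed

theorem theorem4p2:
  fixes U :: "(complex ^ 'n) set" and f :: "complex ^ 'n \<Rightarrow> complex"
    and \<delta> :: real and A :: "int ^ 'n ^ 'm"
  assumes "open U" and "torus \<subseteq> U" and "holomorphic_several f U"
    and "\<delta> > 0" and "annulus \<delta> \<subseteq> U"
    and "ereal_of_enat (rho A) \<ge> ereal (2 * real (ker_dim A) / (3 * \<delta>))"
  shows "ereal (cmod (integral\<^sup>L (haar_push A) f - integral\<^sup>L haar_torus f))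
    \<le> ereal ((real (ker_dim A) + 1) * 3 ^ ker_dim A) *
       (ereal (SUP z\<in>annulus \<delta>. cmod (f z)) / exp_ereal (ereal \<delta> * ereal_of_enat (rho A)))"
proof -
  define M where "M = (SUP z\<in>annulus \<delta>. cmod (f z))"
  define K where "K = {v. v \<noteq> 0 \<and> A *v v = 0}"
  define a where "a = fourier_coeff f"
  have M: "norm (f z) \<le> M" if "z \<in> annulus \<delta>" for z
    using SUP_annulus_attained[OF assms(3,5,4)] that unfolding M_def by metis
  have M0: "0 \<le> M"
    using SUP_annulus_attained[OF assms(3,5,4)] unfolding M_def by (metis norm_ge_zero)
  have cf: "continuous_on torus f"
    using assms(2,3) by (intro continuous_at_imp_continuous_on ballI)
      (auto simp: holomorphic_several_def dest!: has_derivative_continuous)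
  have summ: "(\<lambda>v. norm (fourier_coeff f v)) summable_on UNIV"
    by (rule summable_fourier_coeff[OF assms(3,5,4) M M0])
  have "((\<lambda>v. a v * (\<integral>z. torus_char v z \<partial>haar_push A) - a v * (\<integral>z. torus_char v z \<partial>haar_torus)) has_sum
      (integral\<^sup>L (haar_push A) f - integral\<^sup>L haar_torus f)) UNIV"
    unfolding a_def
    unfolding diff_conv_add_uminus
    by (intro has_sum_add has_sum_uminusI integral_fourier_has_sum cf summ torus_prob_haar_push torus_prob_haar)
  \<comment> \<open>The term v = 0 cancels, since both measures give the trivial character integral
    1; only nonzero kernel vectors survive.\<close>
  moreover have "a v * (\<integral>z. torus_char v z \<partial>haar_push A) - a v * (\<integral>z. torus_char v z \<partial>haar_torus)
      = (if v \<in> K then a v else 0)" for v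
    by (auto simp: integral_haar_push_torus_char integral_torus_char K_def)
  ultimately have sums: "((\<lambda>v. if v \<in> K then a v else 0) has_sum
      (integral\<^sup>L (haar_push A) f - integral\<^sup>L haar_torus f)) UNIV" by simp
  show ?thesis
  proof (cases "rho A")
    case infinity
    then have "K = {}" using rho_le_int_supnorm[of _ A] by (force simp: K_def)
    then have "integral\<^sup>L (haar_push A) f - integral\<^sup>L haar_torus f = 0"
      using sums has_sum_unique[OF sums has_sum_0] by simp
    \<comment> \<open>Here the exponent is \<infinity> because \<delta> > 0, so the right-hand side
      is a real divided by \<infinity>, which is 0, as is the left-hand side.\<close>
    then show ?thesis using infinity assms(4) by simp
  next
    case (enat r)
    define d where "d = ker_dim A"
    have r: "0 < r" using rho_pos[of A] enat by (simp add: zero_enat_def)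
    have rK: "r \<le> int_supnorm v" if "v \<in> K" for v
      using rho_le_int_supnorm[of v A] that enat by (simp add: K_def)
    \<comment> \<open>The hypothesis on \<open>rho A\<close> is exactly the condition d c \<le> 1 of
      \<open>sum_binomial_fact_le\<close> with c = 2 / (3 r \<delta>).\<close>
    have dr: "real d * (2 / (3 * real r * \<delta>)) \<le> 1"
      using assms(4,6) enat r by (simp add: d_def field_simps)
    define B where "B = M * (exp (- \<delta> * real r) * (3 ^ d * (real d + 1)))"
    have part: "norm (\<Sum>v\<in>F. if v \<in> K then a v else 0) \<le> B" if F: "finite F" for F
    proof -
      have "norm (\<Sum>v\<in>F. if v \<in> K then a v else 0) = norm (\<Sum>v\<in>F \<inter> K. a v)"
        using F by (simp add: sum.inter_restrict)
      also have "\<dots> \<le> (\<Sum>v\<in>F \<inter> K. M * exp (- \<delta> * int_supnorm v))"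
        unfolding a_def by (intro sum_norm_le fourier_coeff_bound[OF assms(3,5,4) M])
      also have "\<dots> = M * (\<Sum>v\<in>F \<inter> K. exp (- \<delta> * int_supnorm v))" by (simp add: sum_distrib_left)
      also have "\<dots> \<le> M * (exp (- \<delta> * real r) *
          (3 ^ d * (\<Sum>j\<le>d. real (d choose j) * fact j * (2 / (3 * real r * \<delta>)) ^ j)))"
        unfolding d_def ker_dim_def
      proof (intro mult_left_mono sum_exp_int_supnorm_le subspace_real_ker M0)
        \<comment> \<open>A difference of distinct kernel vectors is again a nonzero kernel vector,
          so minimality of \<open>rho A\<close> also yields separation.\<close>
        fix u v assume "u \<in> F \<inter> K" "v \<in> F \<inter> K" "u \<noteq> v"
        then have "u - v \<in> K"
          by (auto simp: K_def matrix_vector_mult_def vec_eq_iff right_diff_distrib sum_subtractf)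
        then show "r \<le> int_supnorm (u - v)" by (rule rK)
      qed (use F r assms(4) rK in \<open>auto simp: K_def real_vec_in_real_ker\<close>)
      also have "\<dots> \<le> B"
        unfolding B_def using dr r assms(4)
        by (intro mult_left_mono sum_binomial_fact_le M0) auto
      finally show ?thesis .
    qed
    \<comment> \<open>\<open>B\<close> bounds every finite partial sum, and the bound passes to the
      limit along finite subsets.\<close>
    have "norm (integral\<^sup>L (haar_push A) f - integral\<^sup>L haar_torus f) \<le> B"
      using sums unfolding has_sum_def
      by (rule Lim_norm_ubound[rotated]) (auto intro!: eventually_finite_subsets_at_top_weakI part)
    moreover have "B = (real d + 1) * 3 ^ d * (M / exp (\<delta> * real r))"
      by (simp add: B_def exp_minus field_simps)
    ultimately show ?thesis using enat by (simp add: d_def M_def[symmetric])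
  qed
qed

end
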